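(* Let $F$ be a perfect field and let $\mathbf{a}=(a_1,\dots,a_s)$ be a tuple of elements of $F((t))$ of transcendence degree $1$ over $F$. Let $\mathrm{Orb}(\mathbf{a})=\{\sigma(\mathbf{a}) : \sigma\in\mathbf{G}\}$, where $\mathbf{G}$ is the group of automorphisms of the valued field $(F((t)),F[[t]])$ fixing $F$ pointwise (acting coordinatewise on tuples). Then $\mathrm{Orb}(\mathbf{a})$ is (1) definable in $F((t))$ by an existential formula of the language of rings $\{+,\cdot,0,1\}$ with parameters from $F(t)$; (2) definable in $F((t))$ by a formula of the language of rings with parameters from $F$; and (3) equal to the set of realisations in $F((t))$ of the complete type $\mathrm{tp}(\mathbf{a})$ of $\mathbf{a}$ over $F$ in the language of valued fields $\{+,\cdot,0,1,O\}$ (with $O$ interpreted as $F[[t]]$), expanded by constants for the elements of $F$.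
   Context: $F((t))$ is the field of formal Laurent series over $F$, with the $t$-adic valuation $v$, valuation ring $F[[t]]$. Every automorphism in $\mathbf{G}$ is given by a substitution $x\mapsto x\circ s$ for a uniformiser $s$ (element of value $1$). *)

theory Defs
  imports
    "HOL-Computational_Algebra.Computational_Algebra"
    "HOL-Library.Poly_Mapping"
begin

section \<open>Fields and transcendence degree\<close>

definition perfect_field :: "'a::field itself \<Rightarrow> bool" where
  "perfect_field _ \<longleftrightarrow> CHAR('a) = 0 \<or> (\<forall>x::'a. \<exists>y. y ^ CHAR('a) = x)"

definition is_subfield :: "'k::field set \<Rightarrow> bool" where
  "is_subfield L \<longleftrightarrow> 0 \<in> L \<and> 1 \<in> L \<and>
     (\<forall>x\<in>L. \<forall>y\<in>L. x + y \<in> L \<and> x * y \<in> L) \<and>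
     (\<forall>x\<in>L. - x \<in> L \<and> inverse x \<in> L)"

definition adjoin :: "'k::field set \<Rightarrow> 'k set \<Rightarrow> 'k set" where
  "adjoin k S = is_subfield hull (k \<union> S)"

definition algebraic_over :: "'k::field set \<Rightarrow> 'k \<Rightarrow> bool" where
  "algebraic_over k x \<longleftrightarrow> (\<exists>p. p \<noteq> 0 \<and> (\<forall>i. coeff p i \<in> k) \<and> poly p x = 0)"

text \<open>
  In \<^typ>\<open>('k \<Rightarrow>\<^sub>0 nat) \<Rightarrow>\<^sub>0 'k\<close> a multivariate polynomial has the elements of the
  field as names of its variables; \<open>mpoly_eval\<close> gives every variable its own name as value.
\<close>

definition mpoly_eval :: "(('k::field \<Rightarrow>\<^sub>0 nat) \<Rightarrow>\<^sub>0 'k) \<Rightarrow> 'k" where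
  "mpoly_eval p = (\<Sum>m\<in>Poly_Mapping.keys p. Poly_Mapping.lookup p m *
     (\<Prod>x\<in>Poly_Mapping.keys m. x ^ Poly_Mapping.lookup m x))"

definition algebraically_independent :: "'k::field set \<Rightarrow> 'k set \<Rightarrow> bool" where
  "algebraically_independent k B \<longleftrightarrow>
     (\<forall>p. (\<forall>m. Poly_Mapping.lookup p m \<in> k) \<and>
          (\<forall>m\<in>Poly_Mapping.keys p. Poly_Mapping.keys m \<subseteq> B) \<and>
          mpoly_eval p = 0 \<longrightarrow> p = 0)"

text \<open>The extension \<open>k(S)/k\<close> has a transcendence basis with \<open>n\<close> elements.\<close>

definition has_transcendence_degree :: "'k::field set \<Rightarrow> 'k set \<Rightarrow> nat \<Rightarrow> bool" where
  "has_transcendence_degree k S n \<longleftrightarrow>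
     (\<exists>B \<subseteq> adjoin k S. finite B \<and> card B = n \<and> algebraically_independent k B \<and>
        (\<forall>x \<in> adjoin k S. algebraic_over (adjoin k B) x))"


section \<open>First-order formulas in the language of valued fields\<close>

text \<open>
  \<open>InO\<close> is the unary predicate \<open>O\<close>.  Parameters occur as constants \<open>Param c\<close> that denote
  themselves.  The variables are named by natural numbers; a formula that defines a set of
  \<open>s\<close>-tuples has its free variables among \<open>0, \<dots>, s - 1\<close>.
\<close>

datatype (tm_params: 'c) tm =
  Var nat | Param 'c | Zero | One | Add "'c tm" "'c tm" | Mul "'c tm" "'c tm"

datatype (params: 'c) fm =
  Eq "'c tm" "'c tm" | InO "'c tm" | Neg "'c fm" | Conj "'c fm" "'c fm" | Ex nat "'c fm"

primrec tm_vars :: "'c tm \<Rightarrow> nat set" where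
  "tm_vars (Var i) = {i}"
| "tm_vars (Param c) = {}"
| "tm_vars Zero = {}"
| "tm_vars One = {}"
| "tm_vars (Add u w) = tm_vars u \<union> tm_vars w"
| "tm_vars (Mul u w) = tm_vars u \<union> tm_vars w"

primrec free_vars :: "'c fm \<Rightarrow> nat set" where
  "free_vars (Eq u w) = tm_vars u \<union> tm_vars w"
| "free_vars (InO u) = tm_vars u"
| "free_vars (Neg f) = free_vars f"
| "free_vars (Conj f g) = free_vars f \<union> free_vars g"
| "free_vars (Ex i f) = free_vars f - {i}"

primrec tm_val :: "(nat \<Rightarrow> 'k::field) \<Rightarrow> 'k tm \<Rightarrow> 'k" where
  "tm_val e (Var i) = e i"
| "tm_val e (Param c) = c"
| "tm_val e Zero = 0"
| "tm_val e One = 1"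
| "tm_val e (Add u w) = tm_val e u + tm_val e w"
| "tm_val e (Mul u w) = tm_val e u * tm_val e w"

primrec sat :: "'k::field set \<Rightarrow> (nat \<Rightarrow> 'k) \<Rightarrow> 'k fm \<Rightarrow> bool" where
  "sat V e (Eq u w) \<longleftrightarrow> tm_val e u = tm_val e w"
| "sat V e (InO u) \<longleftrightarrow> tm_val e u \<in> V"
| "sat V e (Neg f) \<longleftrightarrow> \<not> sat V e f"
| "sat V e (Conj f g) \<longleftrightarrow> sat V e f \<and> sat V e g"
| "sat V e (Ex i f) \<longleftrightarrow> (\<exists>x. sat V (e(i := x)) f)"

primrec ring_formula :: "'c fm \<Rightarrow> bool" where
  "ring_formula (Eq u w) \<longleftrightarrow> True"
| "ring_formula (InO u) \<longleftrightarrow> False"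
| "ring_formula (Neg f) \<longleftrightarrow> ring_formula f"
| "ring_formula (Conj f g) \<longleftrightarrow> ring_formula f \<and> ring_formula g"
| "ring_formula (Ex i f) \<longleftrightarrow> ring_formula f"

primrec quantifier_free :: "'c fm \<Rightarrow> bool" where
  "quantifier_free (Eq u w) \<longleftrightarrow> True"
| "quantifier_free (InO u) \<longleftrightarrow> True"
| "quantifier_free (Neg f) \<longleftrightarrow> quantifier_free f"
| "quantifier_free (Conj f g) \<longleftrightarrow> quantifier_free f \<and> quantifier_free g"
| "quantifier_free (Ex i f) \<longleftrightarrow> False"

fun existential :: "'c fm \<Rightarrow> bool" where
  "existential (Ex i f) \<longleftrightarrow> existential f"
| "existential f \<longleftrightarrow> quantifier_free f"

definition formulas :: "'c set \<Rightarrow> nat \<Rightarrow> 'c fm set" where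
  "formulas A s = {f. params f \<subseteq> A \<and> free_vars f \<subseteq> {..<s}}"

definition solutions :: "'k::field set \<Rightarrow> nat \<Rightarrow> 'k fm \<Rightarrow> 'k list set" where
  "solutions V s f = {b. length b = s \<and> sat V (\<lambda>i. b ! i) f}"

definition complete_type :: "'k::field set \<Rightarrow> 'k set \<Rightarrow> 'k list \<Rightarrow> 'k fm set" where
  "complete_type V A a = {f \<in> formulas A (length a). sat V (\<lambda>i. a ! i) f}"

definition realisations :: "'k::field set \<Rightarrow> nat \<Rightarrow> 'k fm set \<Rightarrow> 'k list set" where
  "realisations V s T = {b. length b = s \<and> (\<forall>f\<in>T. sat V (\<lambda>i. b ! i) f)}"


section \<open>The valued field of formal Laurent series\<close>

definition constants :: "'a::field fls set" where
  "constants = range fls_const"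

definition power_series :: "'a::field fls set" where
  "power_series = range fps_to_fls"

definition rational_functions :: "'a::field fls set" where
  "rational_functions = adjoin constants {fls_X}"

definition valued_field_automorphisms :: "('a::field fls \<Rightarrow> 'a fls) set" where
  "valued_field_automorphisms =
     {\<sigma>. bij \<sigma> \<and> (\<forall>x y. \<sigma> (x + y) = \<sigma> x + \<sigma> y) \<and> (\<forall>x y. \<sigma> (x * y) = \<sigma> x * \<sigma> y) \<and>
          \<sigma> ` power_series = power_series \<and> (\<forall>c\<in>constants. \<sigma> c = c)}"

definition orbit :: "'a::field fls list \<Rightarrow> 'a fls list set" where
  "orbit a = (\<lambda>\<sigma>. map \<sigma> a) ` valued_field_automorphisms"

end

theory Submission
  imports Defs
begin

text \<open>
  Let \<open>y\<close> be a transcendence basis of \<open>F(a)\<close>.  As \<open>F\<close> is perfect, \<open>y\<close> is a power of some \<open>r\<close> with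
  nonzero derivative, and every \<open>a\<^sub>j\<close> is a simple root of some polynomial \<open>P\<^sub>j(r, Z)\<close> with coefficients
  in \<open>F\<close>.  By a Newton iteration every \<open>x\<close> close to \<open>r\<close> is \<open>r \<circ> s\<close> for a uniformiser \<open>s\<close> close to \<open>t\<close>;
  then \<open>a\<^sub>j \<circ> s\<close> is the only root of \<open>P\<^sub>j(x, Z)\<close> close to \<open>a\<^sub>j\<close>.  After a substitution \<open>t \<mapsto> s\<close> this
  shows that \<open>b\<close> is in the orbit of \<open>a\<close> iff there are a uniformiser \<open>s\<close> and \<open>x\<close> such that \<open>x\<close> and the
  \<open>b\<^sub>j\<close> are close to the truncations of \<open>r\<close> and the \<open>a\<^sub>j\<close> with \<open>s\<close> in place of \<open>t\<close>, and
  \<open>P\<^sub>j(x, b\<^sub>j) = 0\<close>.  This condition is existential in the valuation ring and the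
  uniformisers, which are existentially definable from \<open>t\<close> and definable without parameters.
\<close>

text \<open>The derivative of \<open>r\<close> is the slope of the Newton iteration, so it must not
  vanish. Over a perfect field of characteristic p it vanishes exactly on p-th powers; hence
  \<open>r\<close> is reached by extracting p-th roots. Substitutions carry such conditions for one
  uniformiser to those for another, so one radius found at \<open>a\<close> serves the whole orbit.
  The valuation ring comes from y^2 + y = s x^2 with v(s) = 1: the linear coefficient 1 allows
  solving in every characteristic, and parity of values excludes poles. With s = t this is
  existential. Without t the good s are singled out by a universal condition, so the formula
  obtained over \<open>F\<close> is not existential. For the type, one formula over \<open>F\<close>
  that defines the orbit is enough, as automorphisms preserve all formulas over
  \<open>F\<close>.\<close>

unbundle fps_syntax

section \<open>Solving equations between power series\<close>

lemma fps_X_power_dvd_iff: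
  fixes f :: "'a::comm_ring_1 fps"
  shows "fps_X ^ n dvd f \<longleftrightarrow> (\<forall>i<n. f $ i = 0)"
proof
  assume "fps_X ^ n dvd f"
  then show "\<forall>i<n. f $ i = 0" by (auto simp: dvd_def fps_X_power_mult_nth)
next
  assume "\<forall>i<n. f $ i = 0"
  then have "f = fps_X ^ n * fps_shift n f"
    by (auto simp: fps_eq_iff fps_X_power_mult_nth)
  then show "fps_X ^ n dvd f" by (metis dvd_triv_left)
qed

text \<open>Banach's fixed point theorem for the \<open>fps_X\<close>-adic metric. Each application
  of \<open>\<phi>\<close> gains one order of agreement, so coefficient \<open>n\<close> of the
  iterates of 0 is final after \<open>n + 1\<close> steps and the limit is read off the
  diagonal.\<close>

lemma fps_contraction_fixpoint:
  fixes \<phi> :: "'a::comm_ring_1 fps \<Rightarrow> 'a fps"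
  assumes contr: "\<And>n z w. fps_X ^ n dvd z - w \<Longrightarrow> fps_X ^ Suc n dvd \<phi> z - \<phi> w"
  obtains z where "\<phi> z = z"
proof -
  define z where "z = Abs_fps (\<lambda>n. (\<phi> ^^ Suc n) 0 $ n)"
  have stable: "fps_X ^ n dvd (\<phi> ^^ n) 0 - (\<phi> ^^ (n + m)) 0" for n m
    by (induction n) (auto dest: contr)
  have near: "fps_X ^ n dvd z - (\<phi> ^^ n) 0" for n
    unfolding fps_X_power_dvd_iff
  proof safe
    fix i assume "i < n"
    then have "fps_X ^ Suc i dvd (\<phi> ^^ Suc i) 0 - (\<phi> ^^ n) 0"
      using stable[of "Suc i" "n - Suc i"] by simp
    then show "(z - (\<phi> ^^ n) 0) $ i = 0"
      unfolding fps_X_power_dvd_iff by (auto simp: z_def)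
  qed
  have "(\<phi> z - z) $ n = 0" for n
  proof -
    have "fps_X ^ Suc n dvd \<phi> z - (\<phi> ^^ Suc n) 0" using contr[OF near[of n]] by simp
    moreover have "fps_X ^ Suc n dvd z - (\<phi> ^^ Suc n) 0" by (rule near)
    ultimately have "fps_X ^ Suc n dvd (\<phi> z - (\<phi> ^^ Suc n) 0) - (z - (\<phi> ^^ Suc n) 0)"
      by (rule dvd_diff)
    then show ?thesis unfolding fps_X_power_dvd_iff by simp
  qed
  then have "\<phi> z = z" by (simp add: fps_eq_iff)
  then show thesis by (rule that)
qed

text \<open>Splitting off \<open>A $ 0\<close> leaves \<open>(u - w) * (B oo u)\<close>, which has
  the wanted order, and \<open>w\<close> times the same difference for \<open>B\<close>, where
  \<open>w\<close> contributes one order. Capping the precision at \<open>n\<close> turns this into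
  an induction for all \<open>A\<close> at once.\<close>

lemma fps_compose_cong_mod:
  fixes A u w :: "'a::field fps"
  assumes u: "u $ 0 = 0" and w: "w $ 0 = 0" and uw: "fps_X ^ r dvd u - w"
  shows "fps_X ^ r dvd (A oo u) - (A oo w)"
proof -
  have Xw: "fps_X dvd w" using fps_X_power_dvd_iff[of 1 w] w by simp
  have "fps_X ^ min r n dvd (A oo u) - (A oo w)" for n
  proof (induction n arbitrary: A)
    case (Suc n)
    define B where "B = fps_shift 1 A"
    have A: "A = fps_const (A $ 0) + fps_X * B"
      unfolding B_def by (auto simp: fps_eq_iff)
    have "(A oo u) - (A oo w) = (u - w) * (B oo u) + w * ((B oo u) - (B oo w))"
      by (subst (1 2) A) (simp add: fps_compose_add_distrib fps_compose_mult_distrib u w algebra_simps)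
    moreover have "fps_X ^ min r (Suc n) dvd (u - w) * (B oo u)"
      using uw by (meson dvd_mult2 dvd_trans le_imp_power_dvd min.cobounded1)
    moreover have "fps_X ^ min r (Suc n) dvd w * ((B oo u) - (B oo w))"
    proof -
      have "fps_X ^ Suc (min r n) dvd w * ((B oo u) - (B oo w))"
        using mult_dvd_mono[OF Xw Suc.IH[of B]] by simp
      then show ?thesis by (rule dvd_trans[OF le_imp_power_dvd, rotated]) simp
    qed
    ultimately show ?case by (simp only: dvd_add)
  qed simp
  from this[of r] show ?thesis by simp
qed

text \<open>Peeling off a coefficient as before leaves \<open>u - w\<close> times a difference of
  order \<open>r\<close>, hence order \<open>2 * r\<close>. Nothing is divided by a factorial, so
  this is valid in every characteristic.\<close>

lemma fps_compose_taylor: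
  fixes A u w :: "'a::field fps"
  assumes u: "u $ 0 = 0" and w: "w $ 0 = 0" and uw: "fps_X ^ r dvd u - w"
  shows "fps_X ^ (2 * r) dvd (A oo u) - (A oo w) - (fps_deriv A oo w) * (u - w)"
proof -
  have Xw: "fps_X dvd w" using fps_X_power_dvd_iff[of 1 w] w by simp
  have "fps_X ^ min (2 * r) n dvd (A oo u) - (A oo w) - (fps_deriv A oo w) * (u - w)" for n
  proof (induction n arbitrary: A)
    case (Suc n)
    define B where "B = fps_shift 1 A"
    let ?T = "(B oo u) - (B oo w) - (fps_deriv B oo w) * (u - w)"
    have A: "A = fps_const (A $ 0) + fps_X * B"
      unfolding B_def by (auto simp: fps_eq_iff)
    have "(A oo u) - (A oo w) - (fps_deriv A oo w) * (u - w)
        = (u - w) * ((B oo u) - (B oo w)) + w * ?T"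
      by (subst (1 2 3) A)
        (simp add: fps_compose_add_distrib fps_compose_mult_distrib u w algebra_simps)
    moreover have "fps_X ^ min (2 * r) (Suc n) dvd (u - w) * ((B oo u) - (B oo w))"
    proof -
      have "fps_X ^ (r + r) dvd (u - w) * ((B oo u) - (B oo w))"
        unfolding power_add by (rule mult_dvd_mono[OF uw fps_compose_cong_mod[OF u w uw]])
      then show ?thesis by (rule dvd_trans[OF le_imp_power_dvd, rotated]) simp
    qed
    moreover have "fps_X ^ min (2 * r) (Suc n) dvd w * ?T"
    proof -
      have "fps_X ^ Suc (min (2 * r) n) dvd w * ?T"
        using mult_dvd_mono[OF Xw Suc.IH[of B]] by simp
      then show ?thesis by (rule dvd_trans[OF le_imp_power_dvd, rotated]) simp
    qed
    ultimately show ?case by (simp only: dvd_add)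
  qed simp
  from this[of "2 * r"] show ?thesis by simp
qed

text \<open>Newton's method where the slope \<open>fps_deriv A\<close> may have positive order
  \<open>d\<close>. For \<open>s = fps_X + fps_X ^ K * z\<close> the linear term has order at least
  \<open>K + d\<close> and the Taylor remainder at least \<open>2 * K\<close>; dividing by
  \<open>fps_X ^ (K + d)\<close> leaves \<open>U * z + g z = h\<close> with \<open>U\<close> a unit
  and \<open>g\<close> contracting.\<close>

lemma fps_compose_solve:
  fixes A :: "'a::field fps"
  assumes A': "fps_deriv A \<noteq> 0"
  shows "\<exists>N. \<forall>H. fps_X ^ N dvd H - A \<longrightarrow> (\<exists>s. fps_X ^ k dvd s - fps_X \<and> A oo s = H)"
proof -
  define d where "d = subdegree (fps_deriv A)"
  define U where "U = fps_shift d (fps_deriv A)"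
  have U0: "U $ 0 \<noteq> 0" using nth_subdegree_nonzero[OF A'] by (simp add: U_def d_def del: fps_deriv_nth)
  have dA: "fps_deriv A = fps_X ^ d * U"
    unfolding U_def d_def by (metis mult.commute subdegree_decompose)
  \<comment> \<open>\<open>K >= k\<close> keeps \<open>s z\<close> as close to \<open>fps_X\<close>
    as demanded; \<open>K > d\<close> makes the remainder beat the linear term.\<close>
  define K where "K = k + d + 1"
  define s where "s z = fps_X + fps_X ^ K * z" for z :: "'a fps"
  have s0: "s z $ 0 = 0" for z by (simp add: s_def fps_X_power_mult_nth K_def)
  define G where "G z = (A oo s z) - A - fps_deriv A * (fps_X ^ K * z)" for z
  define g where "g z = fps_shift (K + d) (G z)" for z
  have "fps_X ^ (2 * K) dvd G z" for z
    using fps_compose_taylor[of "s z" fps_X K A] by (simp add: s0 G_def) (simp add: s_def)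
  then have "fps_X ^ (K + d) dvd G z" for z
    by (rule dvd_trans[OF le_imp_power_dvd, rotated]) (simp add: K_def)
  then have Gg: "G z = fps_X ^ (K + d) * g z" for z
    unfolding g_def by (auto simp: fps_X_power_dvd_iff fps_eq_iff fps_X_power_mult_nth)
  have contr: "fps_X ^ Suc n dvd g z - g w" if zw: "fps_X ^ n dvd z - w" for n z w
  proof -
    have diff: "s z - s w = fps_X ^ K * (z - w)" by (simp add: s_def algebra_simps)
    then have d1: "fps_X ^ (K + n) dvd s z - s w" using zw by (simp add: power_add)
    have d2: "fps_X ^ K dvd (fps_deriv A oo s w) - fps_deriv A"
      using fps_compose_cong_mod[of "s w" fps_X K "fps_deriv A"] by (simp add: s0) (simp add: s_def)
    \<comment> \<open>Expanding at \<open>s w\<close> instead of \<open>fps_X\<close> makes the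
      remainder quadratic in \<open>z - w\<close>; changing the slope back costs a product of orders
      \<open>K\<close> and \<open>K + n\<close>.\<close>
    have "G z - G w = ((A oo s z) - (A oo s w) - (fps_deriv A oo s w) * (s z - s w))
        + ((fps_deriv A oo s w) - fps_deriv A) * (s z - s w)"
      unfolding diff G_def by (simp add: algebra_simps)
    moreover have "fps_X ^ (2 * (K + n)) dvd (A oo s z) - (A oo s w) - (fps_deriv A oo s w) * (s z - s w)"
      by (rule fps_compose_taylor[OF s0 s0 d1])
    then have "fps_X ^ (2 * K + n) dvd (A oo s z) - (A oo s w) - (fps_deriv A oo s w) * (s z - s w)"
      by (rule dvd_trans[OF le_imp_power_dvd, rotated]) simp
    moreover have "fps_X ^ (2 * K + n) dvd ((fps_deriv A oo s w) - fps_deriv A) * (s z - s w)"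
      using mult_dvd_mono[OF d2 d1] by (simp add: power_add mult_2 mult.assoc)
    ultimately have "fps_X ^ (2 * K + n) dvd G z - G w" by (simp only: dvd_add)
    then have "fps_X ^ (K + d + Suc n) dvd G z - G w"
      by (rule dvd_trans[OF le_imp_power_dvd, rotated]) (simp add: K_def)
    then show ?thesis unfolding fps_X_power_dvd_iff by (auto simp: g_def)
  qed
  have "\<exists>x. fps_X ^ k dvd x - fps_X \<and> A oo x = H" if H: "fps_X ^ (K + d) dvd H - A" for H
  proof -
    obtain h where h: "H - A = fps_X ^ (K + d) * h" using H by (auto simp: dvd_def)
    obtain z where z: "inverse U * (h - g z) = z"
    proof (rule fps_contraction_fixpoint[of "\<lambda>z. inverse U * (h - g z)"])
      fix n and z w :: "'a fps" assume "fps_X ^ n dvd z - w"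
      then have "fps_X ^ Suc n dvd - (inverse U * (g z - g w))"
        by (intro iffD2[OF dvd_minus_iff] dvd_mult contr)
      then show "fps_X ^ Suc n dvd inverse U * (h - g z) - inverse U * (h - g w)"
        by (simp add: algebra_simps)
    qed auto
    have "U * z = h - g z"
      using U0 by (subst z[symmetric]) (simp add: mult.assoc[symmetric] inverse_mult_eq_1')
    then have "h = U * z + g z" by simp
    then have "H - A = fps_X ^ (K + d) * (U * z) + G z"
      by (simp only: h Gg distrib_left)
    also have "\<dots> = (A oo s z) - A" by (simp add: G_def dA power_add algebra_simps)
    finally have "A oo s z = H" by simp
    moreover have "fps_X ^ k dvd s z - fps_X"
      by (simp add: s_def K_def power_add)
    ultimately show ?thesis by blast
  qed
  then show ?thesis by blast
qed

section \<open>Substitution in Laurent series\<close>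

text \<open>Stated by coefficients because \<open>fls_subdegree 0\<close> is 0, while 0 has to lie
  in all of these fractional ideals.\<close>

definition fls_val_ge :: "int \<Rightarrow> 'a::zero fls set" where
  "fls_val_ge n = {x. \<forall>i<n. x $$ i = 0}"

lemma fls_val_ge_iff: "x \<in> fls_val_ge n \<longleftrightarrow> x = 0 \<or> n \<le> fls_subdegree x"
  unfolding fls_val_ge_def
  by (cases "x = 0") (auto intro: fls_subdegree_geI)

lemma fls_val_ge_0 [simp]: "0 \<in> fls_val_ge n"
  by (simp add: fls_val_ge_def)

lemma fls_val_ge_mono: "x \<in> fls_val_ge n \<Longrightarrow> m \<le> n \<Longrightarrow> x \<in> fls_val_ge m"
  by (auto simp: fls_val_ge_def)

lemma fls_val_ge_add: "x \<in> fls_val_ge n \<Longrightarrow> y \<in> fls_val_ge n \<Longrightarrow> x + y \<in> fls_val_ge n"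
  for x y :: "'a::group_add fls"
  by (auto simp: fls_val_ge_def)

lemma fls_val_ge_mult: "x \<in> fls_val_ge m \<Longrightarrow> y \<in> fls_val_ge n \<Longrightarrow> x * y \<in> fls_val_ge (m + n)"
  for x y :: "'a::field fls"
  by (cases "x = 0"; cases "y = 0") (auto simp: fls_val_ge_iff)

lemma power_series_eq: "power_series = fls_val_ge 0"
proof (intro equalityI subsetI)
  fix x :: "'a fls" assume "x \<in> fls_val_ge 0"
  then have "x = fps_to_fls (fls_regpart x)"
    by (intro fls_eqI) (auto simp: fls_val_ge_def)
  then show "x \<in> power_series" unfolding power_series_def by blast
qed (auto simp: power_series_def fls_val_ge_def)

lemma fps_to_fls_val_ge: "fps_to_fls f \<in> fls_val_ge (int n) \<longleftrightarrow> fps_X ^ n dvd f"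
  for f :: "'a::comm_ring_1 fps"
proof
  assume *: "fps_to_fls f \<in> fls_val_ge (int n)"
  have "f $ i = 0" if "i < n" for i
    using * that by (auto simp: fls_val_ge_def dest: spec[of _ "int i"])
  then show "fps_X ^ n dvd f" by (simp add: fps_X_power_dvd_iff)
qed (auto simp: fls_val_ge_def fps_X_power_dvd_iff nat_less_iff)

lemma uniformiser_of_near_X:
  fixes s :: "'a::field fps"
  assumes "fps_X ^ k dvd s - fps_X" "2 \<le> k"
  shows "s $ 0 = 0" "s $ 1 = 1" "s \<noteq> 0" "subdegree s = 1"
proof -
  have "\<forall>i<2. (s - fps_X) $ i = 0" using assms by (auto simp: fps_X_power_dvd_iff)
  from this[rule_format, of 0] this[rule_format, of 1] show "s $ 0 = 0" "s $ 1 = 1" by auto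
  then show "s \<noteq> 0" "subdegree s = 1" by (auto intro!: subdegreeI)
qed

text \<open>Continuity of substitution at the identity. The pole is cleared by
  \<open>fls_X ^ M\<close>, which the substitution turns into \<open>fps_to_fls s ^ M\<close>; a
  second summand corrects for that.\<close>

lemma fls_compose_near:
  fixes b :: "'a::field fls"
  shows "\<exists>k\<ge>2. \<forall>s. fps_X ^ k dvd s - fps_X \<longrightarrow> fls_compose_fps b s - b \<in> fls_val_ge n"
proof -
  define M where "M = nat (- fls_subdegree b)"
  define B where "B = fls_regpart (b * fls_X ^ M)"
  have "b * fls_X ^ M \<in> fls_val_ge 0" by (cases "b = 0") (auto simp: fls_val_ge_iff M_def)
  then have B: "b * fls_X ^ M = fps_to_fls B"
    unfolding B_def by (intro fls_eqI) (auto simp: fls_val_ge_def)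
  \<comment> \<open>One \<open>M\<close> is lost to the pole of \<open>?c\<close>, the other to the
    division by \<open>fls_X ^ M\<close>; the 2 makes \<open>s\<close> a uniformiser.\<close>
  define k where "k = nat n + 2 * M + 2"
  have "fls_compose_fps b s - b \<in> fls_val_ge n" if s: "fps_X ^ k dvd s - fps_X" for s
  proof -
    have k2: "2 \<le> k" by (simp add: k_def)
    note us = uniformiser_of_near_X[OF s k2]
    let ?c = "fls_compose_fps b s"
    have "?c * fps_to_fls s ^ M = fps_to_fls (B oo s)"
      using arg_cong[OF B, of "\<lambda>x. fls_compose_fps x s"] us
      by (simp add: fls_compose_fps_mult fls_compose_fps_power)
    then have "(?c - b) * fls_X ^ M
        = fps_to_fls ((B oo s) - B) + ?c * (fls_X ^ M - fps_to_fls s ^ M)"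
      by (simp add: algebra_simps B)
    moreover have "fps_to_fls ((B oo s) - B) \<in> fls_val_ge (k - int M)"
      using fps_compose_cong_mod[of s fps_X k B] us s
      by (intro fls_val_ge_mono[OF iffD2[OF fps_to_fls_val_ge[of _ k]]]) auto
    moreover have "?c * (fls_X ^ M - fps_to_fls s ^ M) \<in> fls_val_ge (- int M + int k)"
    proof (rule fls_val_ge_mult)
      show "?c \<in> fls_val_ge (- int M)" using us
        by (auto simp: fls_val_ge_iff M_def)
      have "fls_X ^ M - fps_to_fls s ^ M = fps_to_fls (fps_X ^ M - s ^ M)"
        by (simp add: fps_to_fls_power)
      moreover have "fps_X ^ k dvd fps_X ^ M - s ^ M"
        using fps_compose_cong_mod[of s fps_X k "fps_X ^ M"] us s
        by (simp add: fps_compose_power[symmetric] dvd_diff_commute)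
      ultimately show "fls_X ^ M - fps_to_fls s ^ M \<in> fls_val_ge (int k)"
        by (simp only: fps_to_fls_val_ge)
    qed
    ultimately have "(?c - b) * fls_X ^ M \<in> fls_val_ge (k - int M)"
      by (simp add: fls_val_ge_add)
    then have "?c - b \<in> fls_val_ge (k - int M - int M)"
      by (cases "?c - b = 0") (auto simp: fls_val_ge_iff)
    then show ?thesis by (rule fls_val_ge_mono) (simp add: k_def)
  qed
  then show ?thesis by (intro exI[of _ k]) (simp add: k_def)
qed

text \<open>A pole is removed by passing to \<open>inverse b\<close>, whose derivative is still
  nonzero; inversion does not increase distances between series of negative value.\<close>

lemma fls_compose_solve:
  fixes b :: "'a::field fls"
  assumes b': "fls_deriv b \<noteq> 0" and k: "2 \<le> k"
  shows "\<exists>N. \<forall>c. c - b \<in> fls_val_ge N \<longrightarrow>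
    (\<exists>s. fps_X ^ k dvd s - fps_X \<and> fls_compose_fps b s = c)"
proof -
  have pos: "\<exists>N\<ge>0. \<forall>c. c - b \<in> fls_val_ge N \<longrightarrow>
      (\<exists>s. fps_X ^ k dvd s - fps_X \<and> fls_compose_fps b s = c)"
    if b': "fls_deriv b \<noteq> 0" and b: "b \<in> power_series" for b :: "'a fls"
  proof -
    obtain A where A: "b = fps_to_fls A" using b by (auto simp: power_series_def)
    have "fps_deriv A \<noteq> 0" using b' by (auto simp: A fls_deriv_fps_to_fls)
    from fps_compose_solve[OF this, of k] obtain N where
      N: "\<And>H. fps_X ^ N dvd H - A \<Longrightarrow> \<exists>s. fps_X ^ k dvd s - fps_X \<and> A oo s = H" by blast
    have "\<exists>s. fps_X ^ k dvd s - fps_X \<and> fls_compose_fps b s = c"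
      if c: "c - b \<in> fls_val_ge (int N)" for c
    proof -
      have "c - b \<in> power_series" unfolding power_series_eq by (rule fls_val_ge_mono[OF c]) simp
      then obtain H' where "c - b = fps_to_fls H'" by (auto simp: power_series_def)
      then have H: "c = fps_to_fls (A + H')" by (simp add: A algebra_simps)
      have "fps_X ^ N dvd A + H' - A"
        using c by (simp add: fps_to_fls_val_ge flip: \<open>c - b = fps_to_fls H'\<close>)
          (simp add: \<open>c - b = fps_to_fls H'\<close> fps_to_fls_val_ge)
      from N[OF this] obtain s where s: "fps_X ^ k dvd s - fps_X" "A oo s = A + H'" by blast
      then have "fls_compose_fps b s = c"
        using uniformiser_of_near_X[OF s(1) k] by (simp add: A H)
      then show ?thesis using s by blast
    qed
    then show ?thesis by (intro exI[of _ "int N"]) auto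
  qed
  show ?thesis
  proof (cases "b \<in> power_series")
    case True
    then show ?thesis using pos[OF b'] by blast
  next
    case False
    then have b0: "b \<noteq> 0" and v: "fls_subdegree b < 0"
      by (auto simp: power_series_eq fls_val_ge_iff)
    have "inverse b \<in> power_series" using v by (auto simp: power_series_eq fls_val_ge_iff)
    moreover have "fls_deriv (inverse b) \<noteq> 0" using b' b0 by (simp add: fls_inverse_deriv)
    ultimately obtain N where N0: "N \<ge> 0" and N: "\<And>c. c - inverse b \<in> fls_val_ge N \<Longrightarrow>
        \<exists>s. fps_X ^ k dvd s - fps_X \<and> fls_compose_fps (inverse b) s = c" using pos by blast
    have "\<exists>s. fps_X ^ k dvd s - fps_X \<and> fls_compose_fps b s = c" if c: "c - b \<in> fls_val_ge N" for c
    proof -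
      have c0: "c \<noteq> 0" and vc: "fls_subdegree c < 0"
      proof -
        \<comment> \<open>As \<open>N >= 0\<close> exceeds the value of \<open>b\<close>, the
          leading coefficient of \<open>b\<close> survives in \<open>c\<close>.\<close>
        have "c $$ fls_subdegree b = b $$ fls_subdegree b"
          using c v N0 by (auto simp: fls_val_ge_def)
        then have nz: "c $$ fls_subdegree b \<noteq> 0" using b0 by simp
        then show "c \<noteq> 0" by auto
        show "fls_subdegree c < 0" using fls_subdegree_leI[OF nz] v by simp
      qed
      have "inverse c - inverse b = (b - c) * (inverse b * inverse c)"
        using b0 c0 by (simp add: field_simps)
      moreover have "b - c \<in> fls_val_ge N" using c by (auto simp: fls_val_ge_def)
      moreover have "inverse b * inverse c \<in> fls_val_ge 0"
        using v vc by (cases "inverse b * inverse c = 0") (auto simp: fls_val_ge_iff b0 c0)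
      ultimately have "inverse c - inverse b \<in> fls_val_ge N"
        using fls_val_ge_mult[of "b - c" N "inverse b * inverse c" 0] by simp
      from N[OF this] obtain s where s: "fps_X ^ k dvd s - fps_X"
        "fls_compose_fps (inverse b) s = inverse c" by blast
      then have "fls_compose_fps b s = c"
        using uniformiser_of_near_X[OF s(1) k] by (simp add: fls_compose_fps_inverse)
      then show ?thesis using s by blast
    qed
    then show ?thesis by blast
  qed
qed

lemma fls_compose_automorphism:
  fixes s :: "'a::field fps"
  assumes s: "s $ 0 = 0" "s $ 1 \<noteq> 0"
  shows "(\<lambda>x. fls_compose_fps x s) \<in> valued_field_automorphisms"
proof -
  have ne: "s \<noteq> 0" using s by auto
  define r where "r = fps_inv s"
  have r: "r oo s = fps_X" "s oo r = fps_X"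
    using fps_inv[OF s] fps_inv_right[OF s] by (simp_all add: r_def)
  have r0: "r $ 0 = 0" by (simp add: r_def fps_inv_def)
  have rne: "r \<noteq> 0" using r by auto
  have id: "fls_compose_fps x fps_X = x" for x :: "'a fls"
  proof -
    have "fls_compose_fps x fps_X = fls_compose_fps x (fps_const 1 * fps_X)" by simp
    also have "\<dots> = x" by (intro fls_eqI, subst fls_nth_fls_compose_fps_linear) auto
    finally show ?thesis .
  qed
  have inv: "fls_compose_fps (fls_compose_fps x s) r = x"
       "fls_compose_fps (fls_compose_fps x r) s = x" for x
    using s r0 rne ne by (simp_all add: fls_compose_fps_assoc r id)
  have ps: "fls_compose_fps x u \<in> power_series"
    if "x \<in> power_series" "u \<noteq> 0" "u $ 0 = 0" for x :: "'a fls" and u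
    using that by (auto simp: power_series_def)
  have "bij (\<lambda>x. fls_compose_fps x s)"
    by (rule bij_betw_byWitness[where f' = "\<lambda>x. fls_compose_fps x r"]) (auto simp: inv)
  moreover have "(\<lambda>x. fls_compose_fps x s) ` power_series = power_series"
    using ps[OF _ ne] ps[OF _ rne] s(1) r0 inv by (auto simp: image_iff) metis
  ultimately show ?thesis
    using s ne unfolding valued_field_automorphisms_def
    by (auto simp: fls_compose_fps_add fls_compose_fps_mult constants_def)
qed

section \<open>Frobenius roots\<close>

text \<open>Frobenius is additive on finite sums only, so \<open>g\<close> is cut after exponent
  \<open>n\<close> to compare coefficient \<open>n\<close>; the \<open>p\<close>-th power of the
  tail starts at order \<open>Suc n * p\<close>.\<close>

lemma fps_pth_root:
  fixes f g :: "'a::field fps"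
  assumes p: "prime CHAR('a)" "p = CHAR('a)"
    and g: "\<And>n. (g $ n) ^ p = f $ (p * n)"
    and f: "\<And>n. \<not> p dvd n \<Longrightarrow> f $ n = 0"
  shows "g ^ p = f"
proof -
  have p1: "p > 0" using p by (simp add: prime_gt_0_nat)
  have "(g ^ p) $ n = f $ n" for n
  proof -
    define B where "B = fps_shift (Suc n) g"
    have split: "g = (\<Sum>i<Suc n. fps_const (g $ i) * fps_X ^ i) + fps_X ^ Suc n * B"
      unfolding B_def
      by (rule fps_ext) (auto simp: fps_sum_nth fps_X_power_mult_nth fps_X_power_nth if_distrib
          cong: if_cong simp del: power_Suc sum.lessThan_Suc)
    have "g ^ p = (\<Sum>i<Suc n. (fps_const (g $ i) * fps_X ^ i) ^ p) + (fps_X ^ Suc n * B) ^ p"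
      using p by (subst split) (simp add: freshmans_dream freshmans_dream_sum del: power_Suc sum.lessThan_Suc)
    also have "(fps_X ^ Suc n * B) ^ p = fps_X ^ (Suc n * p) * B ^ p"
      by (simp only: power_mult_distrib power_mult)
    also have "(\<Sum>i<Suc n. (fps_const (g $ i) * fps_X ^ i) ^ p)
        = (\<Sum>i<Suc n. fps_const (f $ (p * i)) * fps_X ^ (i * p))"
      by (simp add: power_mult_distrib fps_const_power g power_mult del: sum.lessThan_Suc)
    finally have "g ^ p = (\<Sum>i<Suc n. fps_const (f $ (p * i)) * fps_X ^ (i * p))
        + fps_X ^ (Suc n * p) * B ^ p" .
    moreover have "n < p + n * p" using p1 by (cases p) auto
    ultimately have "(g ^ p) $ n = (\<Sum>i<Suc n. if n = i * p then f $ (p * i) else 0)"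
      using p1 by (simp add: fps_sum_nth fps_X_power_mult_nth fps_X_power_nth if_distrib
          cong: if_cong del: sum.lessThan_Suc)
    also have "\<dots> = f $ n"
    proof (cases "p dvd n")
      case True
      then obtain m where m: "n = m * p" by (metis dvd_div_mult_self)
      then have "m < Suc n" using p1 by (simp add: less_Suc_eq_le)
      have "(\<Sum>i<Suc n. if n = i * p then f $ (p * i) else 0) = (\<Sum>i<Suc n. if i = m then f $ n else 0)"
        using p1 by (intro sum.cong) (auto simp: m mult.commute)
      then show ?thesis using \<open>m < Suc n\<close> by simp
    next
      case False
      then show ?thesis using f by (auto intro!: sum.neutral)
    qed
    finally show ?thesis .
  qed
  then show ?thesis by (simp add: fps_eq_iff)
qed

lemma fls_pth_root:
  fixes y :: "'a::field fls"
  assumes p: "prime CHAR('a)" "p = CHAR('a)"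
    and perf: "\<And>x::'a. \<exists>y. y ^ p = x"
    and y: "\<And>n. \<not> int p dvd n \<Longrightarrow> y $$ n = 0"
  shows "\<exists>r. r ^ p = y \<and> (\<forall>n. (r $$ n) ^ p = y $$ (int p * n))"
proof -
  have p1: "p > 0" using p by (simp add: prime_gt_0_nat)
  define M where "M = nat (- fls_subdegree y)"
  have M: "y $$ m = 0" if "m < - int M" for m
    using that by (intro fls_eq0_below_subdegree) (simp add: M_def split: if_splits)
  obtain rt where rt: "\<And>x::'a. rt x ^ p = x" using perf by metis
  define g where "g = Abs_fps (\<lambda>n. rt (y $$ (int p * (int n - int M))))"
  \<comment> \<open>The shift by a multiple of \<open>p\<close> clears the pole and keeps the
    exponents divisible by \<open>p\<close>; the root is shifted back by \<open>M\<close>.\<close>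
  define f where "f = Abs_fps (\<lambda>n. y $$ (int n - int p * int M))"
  define r where "r = fls_shift (int M) (fps_to_fls g)"
  have "g ^ p = f"
  proof (rule fps_pth_root[OF p])
    show "(g $ n) ^ p = f $ (p * n)" for n by (simp add: g_def f_def rt algebra_simps)
    show "f $ n = 0" if "\<not> p dvd n" for n
      unfolding f_def fps_nth_Abs_fps
    proof (rule y)
      show "\<not> int p dvd int n - int p * int M" using that
        by (metis dvd_triv_left dvd_diff_right_iff int_dvd_int_iff dvd_diff_commute zdvd_zdiffD)
    qed
  qed
  have r: "r * fls_X ^ M = fps_to_fls g"
    by (simp add: r_def fls_X_power_times_conv_shift)
  have "r ^ p * fls_X ^ (M * p) = fps_to_fls g ^ p"
    by (simp add: power_mult r[symmetric] power_mult_distrib)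
  also have "\<dots> = fps_to_fls f" by (simp add: fps_to_fls_power[symmetric] \<open>g ^ p = f\<close>)
  also have "\<dots> = y * fls_X ^ (M * p)"
  proof (rule fls_eqI)
    fix n
    show "fps_to_fls f $$ n = (y * fls_X ^ (M * p)) $$ n"
    proof (cases "n < 0")
      case True
      have "int M \<le> int M * int p" using mult_left_mono[of 1 "int p" "int M"] p1 by simp
      then have "y $$ (n - int (M * p)) = 0" using True by (intro M) simp
      then show ?thesis using True by (simp add: fls_X_power_times_conv_shift)
    qed (simp add: fls_X_power_times_conv_shift f_def mult.commute)
  qed
  finally have "r ^ p = y" by simp
  moreover have "(r $$ n) ^ p = y $$ (int p * n)" for n
  proof (cases "n + int M < 0")
    case True
    then have "int p * n \<le> n" using p1 by (simp add: mult_le_cancel_right1)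
    then have "y $$ (int p * n) = 0" using True by (intro M) linarith
    then show ?thesis using True p1 by (simp add: r_def zero_power)
  qed (simp add: r_def g_def rt)
  ultimately show ?thesis by blast
qed

lemma fls_deriv_0_dvd:
  fixes y :: "'a::field fls"
  assumes "fls_deriv y = 0" "y $$ n \<noteq> 0"
  shows "int CHAR('a) dvd n"
proof -
  have "of_int n * y $$ n = 0" using arg_cong[OF assms(1), of "\<lambda>y. y $$ (n - 1)"] by simp
  then have "of_int n = (0::'a)" using assms(2) by simp
  then show ?thesis by (simp add: of_int_eq_0_iff_char_dvd)
qed

lemma perfect_fieldD:
  assumes "perfect_field TYPE('a::field)" "CHAR('a) > 0"
  shows "prime CHAR('a)" "\<exists>y. y ^ CHAR('a) = (x::'a)"
  using assms prime_CHAR_semidom by (auto simp: perfect_field_def)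

text \<open>While the derivative is 0, a \<open>p\<close>-th root exists and its exponents are those
  of \<open>y\<close> divided by \<open>p\<close>. A nonzero exponent \<open>i\<close> with nonzero
  coefficient is carried along; its absolute value shrinks, so the process stops.\<close>

lemma nonconstant_eq_power_of_separable:
  fixes y :: "'a::field fls"
  assumes perf: "perfect_field TYPE('a)" and y: "y \<notin> constants"
  shows "\<exists>r q. y = r ^ q \<and> fls_deriv r \<noteq> 0"
proof -
  have "\<exists>r q. y = r ^ q \<and> fls_deriv r \<noteq> 0" if "y $$ i \<noteq> 0" "i \<noteq> 0" for i and y :: "'a fls"
    using that
  proof (induction "nat \<bar>i\<bar>" arbitrary: i y rule: less_induct)
    case less
    show ?case
    proof (cases "fls_deriv y = 0")
      case False
      then show ?thesis by (metis power_one_right)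
    next
      case True
      define p where "p = CHAR('a)"
      have dvd: "int p dvd n" if "y $$ n \<noteq> 0" for n
        using fls_deriv_0_dvd[OF True that] by (simp add: p_def)
      obtain m where m: "i = int p * m" using dvd[OF less.prems(1)] by blast
      \<comment> \<open>In characteristic 0 divisibility by \<open>p = 0\<close> would give
        \<open>i = 0\<close>.\<close>
      then have p0: "p > 0" "m \<noteq> 0" using less.prems by auto
      note pr = perfect_fieldD[OF perf, folded p_def, OF p0(1)]
      have p2: "p \<ge> 2" using pr(1) by (simp add: prime_ge_2_nat)
      obtain r where r: "r ^ p = y" "\<And>n. (r $$ n) ^ p = y $$ (int p * n)"
        using fls_pth_root[of p y] pr dvd by (auto simp: p_def)
      have "r $$ m \<noteq> 0" using r(2)[of m] less.prems m p0 by (metis zero_power)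
      moreover have "nat \<bar>m\<bar> < nat \<bar>i\<bar>"
      proof -
        have "\<bar>i\<bar> = int p * \<bar>m\<bar>" by (simp add: m abs_mult)
        moreover have "2 * \<bar>m\<bar> \<le> int p * \<bar>m\<bar>" using p2 by (intro mult_right_mono) auto
        ultimately show ?thesis using p0 by simp
      qed
      ultimately obtain r' q where "r = r' ^ q" "fls_deriv r' \<noteq> 0" using less.hyps p0 by blast
      then show ?thesis using r(1) by (metis power_mult)
    qed
  qed
  moreover have "\<exists>i. y $$ i \<noteq> 0 \<and> i \<noteq> 0"
  proof (rule ccontr)
    assume "\<not> ?thesis"
    then have "y = fls_const (y $$ 0)" by (intro fls_eqI) auto
    then show False using y by (auto simp: constants_def)
  qed
  ultimately show ?thesis by blast
qed

section \<open>Separable relations between two Laurent series\<close>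

definition bipoly :: "(nat \<Rightarrow> nat \<Rightarrow> 'a::field) \<Rightarrow> nat \<Rightarrow> 'a fls \<Rightarrow> 'a fls \<Rightarrow> 'a fls" where
  "bipoly c D y z = (\<Sum>i<D. \<Sum>j<D. fls_const (c i j) * y ^ i * z ^ j)"

text \<open>Guarantees that the square sum \<open>bipoly c D\<close> omits no coefficient. Total
  degree is the induction measure because both partial derivatives and \<open>p\<close>-th roots of
  nonconstant relations lower it.\<close>

definition total_degree_less :: "(nat \<Rightarrow> nat \<Rightarrow> 'a::zero) \<Rightarrow> nat \<Rightarrow> bool" where
  "total_degree_less c D \<longleftrightarrow> (\<forall>i j. c i j \<noteq> 0 \<longrightarrow> i + j < D)"

definition deriv1 :: "(nat \<Rightarrow> nat \<Rightarrow> 'a::semiring_1) \<Rightarrow> nat \<Rightarrow> nat \<Rightarrow> 'a" where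
  "deriv1 c i j = of_nat (Suc i) * c (Suc i) j"

definition deriv2 :: "(nat \<Rightarrow> nat \<Rightarrow> 'a::semiring_1) \<Rightarrow> nat \<Rightarrow> nat \<Rightarrow> 'a" where
  "deriv2 c i j = of_nat (Suc j) * c i (Suc j)"

lemma total_degree_less_deriv:
  assumes "total_degree_less c D"
  shows "total_degree_less (deriv1 c) (D - 1)" "total_degree_less (deriv2 c) (D - 1)"
proof -
  have "c (Suc i) j \<noteq> 0 \<Longrightarrow> i + j < D - 1" "c i (Suc j) \<noteq> 0 \<Longrightarrow> i + j < D - 1" for i j
    using assms unfolding total_degree_less_def by fastforce+
  then show "total_degree_less (deriv1 c) (D - 1)" "total_degree_less (deriv2 c) (D - 1)"
    unfolding total_degree_less_def deriv1_def deriv2_def by (metis mult_zero_right)+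
qed

lemma bipoly_eq:
  assumes "total_degree_less c D" "D \<le> D'"
  shows "bipoly c D y z = bipoly c D' y z"
proof -
  have c0: "c i j = 0" if "D \<le> i + j" for i j
    using assms(1) that unfolding total_degree_less_def by (meson not_le)
  have "bipoly c D y z = (\<Sum>i<D. \<Sum>j<D'. fls_const (c i j) * y ^ i * z ^ j)"
    unfolding bipoly_def using assms
    by (intro sum.cong[OF refl], intro sum.mono_neutral_left) (auto simp: c0)
  also have "\<dots> = bipoly c D' y z"
    unfolding bipoly_def using assms
    by (intro sum.mono_neutral_left) (auto simp: c0 intro!: sum.neutral)
  finally show ?thesis .
qed

text \<open>The index shift of a formal derivative. At \<open>i = 0\<close> the truncated
  \<open>i - 1\<close> is harmless, since \<open>of_nat 0\<close> kills the term.\<close>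

lemma sum_shift_of_nat:
  fixes f :: "nat \<Rightarrow> 'b::semiring_1"
  assumes "f D = 0"
  shows "(\<Sum>i<D. of_nat (Suc i) * f (Suc i) * g i) = (\<Sum>i<D. of_nat i * f i * g (i - 1))"
proof -
  have "(\<Sum>i<D. of_nat (Suc i) * f (Suc i) * g i) = (\<Sum>i<Suc D. of_nat i * f i * g (i - 1))"
    by (subst sum.lessThan_Suc_shift) simp
  also have "\<dots> = (\<Sum>i<D. of_nat i * f i * g (i - 1))" using assms by simp
  finally show ?thesis .
qed

lemma bipoly_deriv1:
  assumes "total_degree_less c D"
  shows "bipoly (deriv1 c) D y z = (\<Sum>i<D. \<Sum>j<D. of_nat i * fls_const (c i j) * y ^ (i - 1) * z ^ j)"
proof -
  have "bipoly (deriv1 c) D y z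
      = (\<Sum>j<D. \<Sum>i<D. of_nat (Suc i) * fls_const (c (Suc i) j) * (y ^ i * z ^ j))"
    unfolding bipoly_def by (subst sum.swap)
      (simp add: deriv1_def fls_of_nat mult.assoc del: of_nat_Suc flip: fls_const_mult_const)
  also have "\<dots> = (\<Sum>j<D. \<Sum>i<D. of_nat i * fls_const (c i j) * (y ^ (i - 1) * z ^ j))"
    using assms by (intro sum.cong refl sum_shift_of_nat) (auto simp: total_degree_less_def)
  also have "\<dots> = (\<Sum>i<D. \<Sum>j<D. of_nat i * fls_const (c i j) * y ^ (i - 1) * z ^ j)"
    by (subst sum.swap) (simp add: mult.assoc)
  finally show ?thesis .
qed

lemma bipoly_deriv2:
  assumes "total_degree_less c D"
  shows "bipoly (deriv2 c) D y z = (\<Sum>i<D. \<Sum>j<D. of_nat j * fls_const (c i j) * y ^ i * z ^ (j - 1))"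
proof -
  have "bipoly (deriv2 c) D y z
      = (\<Sum>i<D. \<Sum>j<D. of_nat (Suc j) * fls_const (c i (Suc j)) * (y ^ i * z ^ j))"
    unfolding bipoly_def
    by (simp add: deriv2_def fls_of_nat mult.assoc del: of_nat_Suc flip: fls_const_mult_const)
  also have "\<dots> = (\<Sum>i<D. \<Sum>j<D. of_nat j * fls_const (c i j) * (y ^ i * z ^ (j - 1)))"
    using assms by (intro sum.cong refl sum_shift_of_nat) (auto simp: total_degree_less_def)
  finally show ?thesis by (simp add: mult.assoc)
qed

lemma fls_deriv_bipoly:
  assumes "total_degree_less c D"
  shows "fls_deriv (bipoly c D y z)
    = bipoly (deriv1 c) D y z * fls_deriv y + bipoly (deriv2 c) D y z * fls_deriv z"
  unfolding bipoly_deriv1[OF assms] bipoly_deriv2[OF assms]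
  unfolding bipoly_def fls_deriv_sum sum_distrib_right sum.distrib[symmetric]
  by (intro sum.cong refl) (simp add: fls_deriv_power algebra_simps)

lemma bipoly_pth_root:
  fixes c :: "nat \<Rightarrow> nat \<Rightarrow> 'a::field"
  assumes p: "prime CHAR('a)" "p = CHAR('a)" and c: "total_degree_less c D"
    and dvd: "\<And>i j. c i j \<noteq> 0 \<Longrightarrow> p dvd i \<and> p dvd j"
    and d: "\<And>i j. d i j ^ p = c (p * i) (p * j)"
  shows "bipoly d D y z ^ p = bipoly c D y z"
proof -
  have p1: "p > 0" using p by (simp add: prime_gt_0_nat)
  define t where "t i j = fls_const (c i j) * y ^ i * z ^ j" for i j
  have t0: "t i j = 0" if "\<not> (i + j < D \<and> p dvd i \<and> p dvd j)" for i j
    using that c dvd[of i j] by (auto simp: t_def total_degree_less_def)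
  have "bipoly d D y z ^ p = (\<Sum>i<D. \<Sum>j<D. fls_const (d i j ^ p) * (y ^ i) ^ p * (z ^ j) ^ p)"
    using p by (simp add: bipoly_def freshmans_dream_sum power_mult_distrib fls_const_power)
  also have "\<dots> = (\<Sum>i<D. \<Sum>j<D. t (p * i) (p * j))"
    by (simp add: d t_def mult.commute flip: power_mult)
  also have "\<dots> = (\<Sum>(i, j)\<in>{..<D} \<times> {..<D}. t (p * i) (p * j))"
    by (rule sum.cartesian_product)
  also have "\<dots> = (\<Sum>(i, j)\<in>(\<lambda>(i, j). (p * i, p * j)) ` ({..<D} \<times> {..<D}). t i j)"
    using p1 by (subst sum.reindex) (auto simp: inj_on_def intro!: sum.cong)
  \<comment> \<open>Neither index set need contain the other: scaling by \<open>p\<close> leaves the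
    square, and the square has pairs not divisible by \<open>p\<close>. Both sums are compared on
    the union, where \<open>t\<close> vanishes at the extra pairs.\<close>
  also have "\<dots> = (\<Sum>(i, j)\<in>({..<D} \<times> {..<D}) \<union> (\<lambda>(i, j). (p * i, p * j)) ` ({..<D} \<times> {..<D}). t i j)"
  proof (rule sum.mono_neutral_left)
    show "\<forall>ij\<in>({..<D} \<times> {..<D}) \<union> (\<lambda>(i, j). (p * i, p * j)) ` ({..<D} \<times> {..<D})
        - (\<lambda>(i, j). (p * i, p * j)) ` ({..<D} \<times> {..<D}). (case ij of (i, j) \<Rightarrow> t i j) = 0"
    proof
      fix ij assume ij: "ij \<in> ({..<D} \<times> {..<D}) \<union> (\<lambda>(i, j). (p * i, p * j)) ` ({..<D} \<times> {..<D})
        - (\<lambda>(i, j). (p * i, p * j)) ` ({..<D} \<times> {..<D})"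
      obtain i j where [simp]: "ij = (i, j)" by fastforce
      have False if d: "p dvd i" "p dvd j"
      proof -
        obtain i' j' where e: "i = p * i'" "j = p * j'" using d by (elim dvdE)
        have "i' \<le> i" "j' \<le> j" using p1 by (simp_all add: e)
        moreover have "i < D" "j < D" using ij by auto
        ultimately have "i' < D" "j' < D" by auto
        then have "(i, j) \<in> (\<lambda>(i, j). (p * i, p * j)) ` ({..<D} \<times> {..<D})"
          using ij by (intro image_eqI[of _ _ "(i', j')"]) (simp_all add: e)
        then show False using ij by simp
      qed
      then show "(case ij of (i, j) \<Rightarrow> t i j) = 0" using t0[of i j] by auto
    qed
  qed auto
  also have "\<dots> = (\<Sum>(i, j)\<in>{..<D} \<times> {..<D}. t i j)"
    by (rule sum.mono_neutral_right) (auto intro!: t0)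
  also have "\<dots> = bipoly c D y z"
    by (simp add: bipoly_def t_def sum.cartesian_product)
  finally show ?thesis .
qed

text \<open>
  In a nonzero relation of minimal degree the derivative with respect to \<open>z\<close> does not vanish at
  \<open>(r, z)\<close>: otherwise it is zero by minimality, differentiating the relation gives the same for
  the derivative with respect to \<open>y\<close> since \<open>r\<close> has nonzero derivative, and then the relation is
  the \<open>p\<close>-th power of one of smaller degree.
\<close>

lemma separable_relation:
  fixes r z :: "'a::field fls"
  assumes perf: "perfect_field TYPE('a)" and r: "fls_deriv r \<noteq> 0"
    and "total_degree_less c D" "c i j \<noteq> 0" "bipoly c D r z = 0"
  shows "\<exists>c D. total_degree_less c D \<and> bipoly c D r z = 0 \<and> bipoly (deriv2 c) D r z \<noteq> 0"
  using assms(3-)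
proof (induction D arbitrary: c i j rule: less_induct)
  case (less D)
  have "i + j < D" using less.prems by (auto simp: total_degree_less_def)
  then have "D > 0" by simp
  note td = total_degree_less_deriv[OF less.prems(1)]
  show ?case
  proof (cases "bipoly (deriv2 c) D r z = 0")
    case False
    then show ?thesis using less.prems by blast
  next
    case zero2: True
    have "bipoly (deriv1 c) D r z * fls_deriv r = 0"
      using arg_cong[OF less.prems(3), of fls_deriv] zero2 by (simp add: fls_deriv_bipoly[OF less.prems(1)])
    then have zero1: "bipoly (deriv1 c) D r z = 0" using r by simp
    show ?thesis
    proof (cases "\<exists>i j. deriv1 c i j \<noteq> 0 \<or> deriv2 c i j \<noteq> 0")
      case True
      then show ?thesis
        using less.IH[of "D - 1" "deriv1 c"] less.IH[of "D - 1" "deriv2 c"] td zero1 zero2 \<open>D > 0\<close>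
          bipoly_eq[OF td(1), of D r z] bipoly_eq[OF td(2), of D r z] by fastforce
    next
      case False
      define p where "p = CHAR('a)"
      have dvd: "p dvd i \<and> p dvd j" if "c i j \<noteq> 0" for i j
      proof
        show "p dvd i" using False that
          by (cases i) (auto simp: deriv1_def p_def of_nat_eq_0_iff_char_dvd simp del: of_nat_Suc)
        show "p dvd j" using False that
          by (cases j) (auto simp: deriv2_def p_def of_nat_eq_0_iff_char_dvd simp del: of_nat_Suc)
      qed
      \<comment> \<open>A constant relation would force its constant to be 0. The monomial found
        here excludes characteristic 0 and gives \<open>D >= 2\<close>.\<close>
      have "\<exists>i j. c i j \<noteq> 0 \<and> i + j > 0"
      proof (rule ccontr)
        assume "\<not> ?thesis"
        then have *: "c i j = 0" if "i + j > 0" for i j using that by blast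
        then have "total_degree_less c 1" by (auto simp: total_degree_less_def intro: ccontr)
        then have "bipoly c D r z = bipoly c 1 r z" using bipoly_eq[of c 1 D r z] \<open>D > 0\<close> by simp
        then have "c 0 0 = 0" using less.prems(3) by (simp add: bipoly_def)
        then show False using * less.prems(2) by (metis gr0I add_is_0)
      qed
      then obtain i j where ij: "c i j \<noteq> 0" "i + j > 0" by blast
      have p0: "p > 0" using dvd[OF ij(1)] ij(2) by (auto intro: gr0I)
      note pr = perfect_fieldD[OF perf, folded p_def, OF p0]
      obtain rt where rt: "\<And>x::'a. rt x ^ p = x" using pr(2) by metis
      have rt0: "rt 0 = 0" using rt[of 0] p0 by (metis power_eq_0_iff)
      define d where "d i j = rt (c (p * i) (p * j))" for i j
      have d0: "d i j \<noteq> 0 \<longleftrightarrow> c (p * i) (p * j) \<noteq> 0" for i j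
        using rt[of "c (p * i) (p * j)"] rt0 p0 unfolding d_def by (metis power_eq_0_iff)
      have p2: "p \<ge> 2" using pr(1) by (simp add: prime_ge_2_nat p_def)
      \<comment> \<open>\<open>p >= 2\<close> gives \<open>2 * (k + l) < D\<close>, which together
        with \<open>D >= 2\<close> forces \<open>k + l < D - 1\<close>.\<close>
      have td': "total_degree_less d (D - 1)"
        unfolding total_degree_less_def
      proof (intro allI impI)
        fix k l assume "d k l \<noteq> 0"
        then have "p * k + p * l < D" using less.prems(1) d0 by (auto simp: total_degree_less_def)
        moreover have "2 * k \<le> p * k" "2 * l \<le> p * l" using p2 by auto
        moreover have "i + j < D" using less.prems(1) ij by (auto simp: total_degree_less_def)
        ultimately show "k + l < D - 1" using ij(2) by linarith
      qed
      have "bipoly d D r z ^ p = bipoly c D r z"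
        by (rule bipoly_pth_root[OF _ p_def less.prems(1) dvd])
          (use pr(1) in \<open>simp_all add: d_def rt flip: p_def\<close>)
      then have "bipoly d (D - 1) r z = 0"
        using less.prems(3) bipoly_eq[OF td', of D r z] by simp
      moreover obtain k l where "i = p * k" "j = p * l" using dvd[OF ij(1)] by (auto simp: dvd_def)
      ultimately show ?thesis using less.IH[of "D - 1" d k l] td' \<open>D > 0\<close> d0 ij by auto
    qed
  qed
qed

section \<open>Separable roots are isolated\<close>

text \<open>Convergence in the valuation topology: continuity of polynomial expressions replaces
  explicit radii in the isolation of roots.\<close>

definition fls_tends :: "(nat \<Rightarrow> 'a::field fls) \<Rightarrow> 'a fls \<Rightarrow> bool" where
  "fls_tends X L \<longleftrightarrow> (\<forall>n. \<forall>\<^sub>F k in sequentially. X k - L \<in> fls_val_ge n)"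

lemma fls_tends_const: "fls_tends (\<lambda>_. c) c"
  by (simp add: fls_tends_def)

lemma fls_tends_add: "fls_tends X L \<Longrightarrow> fls_tends Y M \<Longrightarrow> fls_tends (\<lambda>k. X k + Y k) (L + M)"
  unfolding fls_tends_def
proof
  fix n
  assume "\<forall>n. \<forall>\<^sub>F k in sequentially. X k - L \<in> fls_val_ge n"
    "\<forall>n. \<forall>\<^sub>F k in sequentially. Y k - M \<in> fls_val_ge n"
  then have "\<forall>\<^sub>F k in sequentially. X k - L \<in> fls_val_ge n"
    "\<forall>\<^sub>F k in sequentially. Y k - M \<in> fls_val_ge n" by auto
  then show "\<forall>\<^sub>F k in sequentially. X k + Y k - (L + M) \<in> fls_val_ge n"
    by eventually_elim (metis fls_val_ge_add add_diff_add)
qed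

lemma fls_tends_mult:
  assumes "fls_tends X L" "fls_tends Y M"
  shows "fls_tends (\<lambda>k. X k * Y k) (L * M)"
  unfolding fls_tends_def
proof
  fix n
  define m where "m = min 0 (min (fls_subdegree L) (fls_subdegree M))"
  have m: "m \<le> 0" "L \<in> fls_val_ge m" "M \<in> fls_val_ge m" by (auto simp: fls_val_ge_iff m_def)
  \<comment> \<open>The mixed terms have value at least \<open>N + m >= n\<close>; the
    \<open>max\<close> keeps \<open>N\<close> nonnegative, so that the product of both errors has
    value at least \<open>2 * N >= n\<close>.\<close>
  define N where "N = max n 0 - m"
  have "\<forall>\<^sub>F k in sequentially. X k - L \<in> fls_val_ge N" "\<forall>\<^sub>F k in sequentially. Y k - M \<in> fls_val_ge N"
    using assms by (auto simp: fls_tends_def)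
  then show "\<forall>\<^sub>F k in sequentially. X k * Y k - L * M \<in> fls_val_ge n"
  proof eventually_elim
    case (elim k)
    have "X k * Y k - L * M = ((X k - L) * (Y k - M) + (X k - L) * M) + L * (Y k - M)"
      by (simp add: algebra_simps)
    moreover have "(X k - L) * (Y k - M) \<in> fls_val_ge n" "(X k - L) * M \<in> fls_val_ge n"
      "L * (Y k - M) \<in> fls_val_ge n"
      using fls_val_ge_mult[OF elim(1) elim(2)] fls_val_ge_mult[OF elim(1) m(3)]
        fls_val_ge_mult[OF m(2) elim(2)] m(1)
      by (auto elim!: fls_val_ge_mono simp: N_def)
    ultimately show ?case by (simp add: fls_val_ge_add)
  qed
qed

lemma fls_tends_power: "fls_tends X L \<Longrightarrow> fls_tends (\<lambda>k. X k ^ n) (L ^ n)"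
  by (induction n) (auto intro: fls_tends_const fls_tends_mult)

lemma fls_tends_sum:
  "(\<And>i. i \<in> A \<Longrightarrow> fls_tends (\<lambda>k. X i k) (L i)) \<Longrightarrow> fls_tends (\<lambda>k. \<Sum>i\<in>A. X i k) (\<Sum>i\<in>A. L i)"
  by (induction A rule: infinite_finite_induct) (auto intro: fls_tends_const fls_tends_add)

text \<open>\<open>Q\<close> is the divided difference in the second variable: two roots over the
  same \<open>y\<close> satisfy \<open>(z' - z) * Q = 0\<close>. It is continuous and its value at
  \<open>(r, a, a)\<close> is the nonzero derivative, so distinct roots cannot both be arbitrarily
  close to \<open>a\<close>.\<close>

lemma bipoly_root_unique_near:
  fixes r a :: "'a::field fls"
  assumes c: "total_degree_less c D" and sep: "bipoly (deriv2 c) D r a \<noteq> 0"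
  shows "\<exists>N::nat. \<forall>y z z'. y - r \<in> fls_val_ge N \<and> z - a \<in> fls_val_ge N \<and> z' - a \<in> fls_val_ge N \<and>
    bipoly c D y z = 0 \<and> bipoly c D y z' = 0 \<longrightarrow> z = z'"
proof (rule ccontr)
  assume "\<not> ?thesis"
  then obtain y z z' :: "nat \<Rightarrow> 'a fls" where near: "\<And>N::nat. y N - r \<in> fls_val_ge N" "\<And>N::nat. z N - a \<in> fls_val_ge N"
      "\<And>N::nat. z' N - a \<in> fls_val_ge N"
    and zero: "\<And>N. bipoly c D (y N) (z N) = 0" "\<And>N. bipoly c D (y N) (z' N) = 0"
    and ne: "\<And>N. z N \<noteq> z' N"
    by metis
  have tends: "fls_tends X L" if "\<And>N::nat. X N - L \<in> fls_val_ge N" for X :: "nat \<Rightarrow> 'a fls" and L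
    unfolding fls_tends_def
  proof
    fix n
    show "\<forall>\<^sub>F k in sequentially. X k - L \<in> fls_val_ge n"
      using eventually_ge_at_top[of "nat n"]
      by eventually_elim (rule fls_val_ge_mono[OF that], simp)
  qed
  define Q where "Q y z z' = (\<Sum>i<D. \<Sum>j<D. fls_const (c i j) * y ^ i * (\<Sum>k<j. z ^ (j - Suc k) * z' ^ k))"
    for y z z' :: "'a fls"
  have "(z' N - z N) * Q (y N) (z N) (z' N) = bipoly c D (y N) (z' N) - bipoly c D (y N) (z N)" for N
    unfolding Q_def bipoly_def sum_distrib_left sum_subtractf[symmetric]
    by (intro sum.cong refl)
      (simp add: power_diff_sumr2 sum_distrib_left mult_ac flip: right_diff_distrib)
  then have "z' N = z N \<or> Q (y N) (z N) (z' N) = 0" for N by (simp add: zero)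
  then have Q0: "Q (y N) (z N) (z' N) = 0" for N using ne by metis
  have "fls_tends (\<lambda>N. Q (y N) (z N) (z' N)) (Q r a a)"
    unfolding Q_def
    by (intro fls_tends_sum fls_tends_mult fls_tends_power fls_tends_const
        tends[OF near(1)] tends[OF near(2)] tends[OF near(3)])
  moreover have "Q r a a = bipoly (deriv2 c) D r a"
  proof -
    have "(\<Sum>k<j. a ^ (j - Suc k) * a ^ k) = of_nat j * a ^ (j - 1)" for j
      by (simp flip: power_add)
    then show ?thesis unfolding Q_def bipoly_deriv2[OF c] by (simp add: mult_ac)
  qed
  ultimately have "fls_tends (\<lambda>N. 0) (bipoly (deriv2 c) D r a)" by (simp add: Q0)
  then have "- bipoly (deriv2 c) D r a \<in> fls_val_ge n" for n by (simp add: fls_tends_def)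
  then have "bipoly (deriv2 c) D r a $$ n = 0" for n
    by (simp add: fls_val_ge_def) (meson lessI zless_add1_eq)
  then show False using sep by (auto intro: fls_eqI)
qed

section \<open>Transcendence degree one\<close>

lemma is_subfield_adjoin: "is_subfield (adjoin k S)"
  unfolding adjoin_def by (rule hull_in) (auto simp: is_subfield_def)

lemma subset_adjoin: "k \<union> S \<subseteq> adjoin k S"
  unfolding adjoin_def by (rule hull_subset)

lemma adjoin_minimal: "is_subfield L \<Longrightarrow> k \<union> S \<subseteq> L \<Longrightarrow> adjoin k S \<subseteq> L"
  unfolding adjoin_def by (rule hull_minimal)

definition fls_poly :: "'a::field poly \<Rightarrow> 'a fls \<Rightarrow> 'a fls" where
  "fls_poly f r = poly (map_poly fls_const f) r"

lemma fls_poly_simps [simp]: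
  "fls_poly 0 r = 0" "fls_poly [:c:] r = fls_const c" "fls_poly 1 r = 1"
  "fls_poly (pCons c f) r = fls_const c + r * fls_poly f r"
  by (simp_all add: fls_poly_def map_poly_pCons one_pCons)

lemma fls_poly_add: "fls_poly (f + g) r = fls_poly f r + fls_poly g r"
proof -
  have "map_poly fls_const (f + g) = map_poly fls_const f + map_poly fls_const g"
    by (simp add: poly_eq_iff coeff_map_poly fls_plus_const)
  then show ?thesis by (simp add: fls_poly_def)
qed

lemma fls_poly_smult: "fls_poly (smult c f) r = fls_const c * fls_poly f r"
  by (simp add: fls_poly_def map_poly_smult)

lemma fls_poly_mult: "fls_poly (f * g) r = fls_poly f r * fls_poly g r"
  by (induction f) (simp_all add: fls_poly_add fls_poly_smult algebra_simps)

lemma fls_poly_altdef: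
  assumes "degree f < D"
  shows "fls_poly f r = (\<Sum>i<D. fls_const (coeff f i) * r ^ i)"
proof -
  have "degree (map_poly fls_const f) < D"
    using assms by (subst degree_map_poly) auto
  then have "fls_poly f r = (\<Sum>i<D. coeff (map_poly fls_const f) i * r ^ i)"
    unfolding fls_poly_def poly_altdef
    by (intro sum.mono_neutral_left) (auto simp: coeff_eq_0)
  then show ?thesis by (simp add: coeff_map_poly)
qed

text \<open>The fractions form a subfield containing the generators. Written by
  cross-multiplication, their closure properties become polynomial identities.\<close>

lemma adjoin_fractions:
  assumes "u \<in> adjoin constants {r}"
  shows "\<exists>f g. fls_poly g r \<noteq> 0 \<and> u * fls_poly g r = fls_poly f r"
proof -
  let ?L = "{u. \<exists>f g. fls_poly g r \<noteq> 0 \<and> u * fls_poly g r = fls_poly f r}"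
  have "is_subfield ?L"
    unfolding is_subfield_def
  proof (intro conjI ballI)
    show "0 \<in> ?L" by (intro CollectI exI[of _ 0] exI[of _ 1]) simp
    show "1 \<in> ?L" by (intro CollectI exI[of _ 1]) simp
  next
    fix u v assume "u \<in> ?L" "v \<in> ?L"
    then obtain f g f' g' where *: "fls_poly g r \<noteq> 0" "u * fls_poly g r = fls_poly f r"
      "fls_poly g' r \<noteq> 0" "v * fls_poly g' r = fls_poly f' r" by blast
    have "(u + v) * fls_poly (g * g') r = fls_poly (f * g' + g * f') r"
      by (simp add: fls_poly_mult fls_poly_add algebra_simps flip: *(2,4))
    moreover have "u * v * fls_poly (g * g') r = fls_poly (f * f') r"
      by (simp add: fls_poly_mult algebra_simps flip: *(2,4))
    moreover have "fls_poly (g * g') r \<noteq> 0" using * by (simp add: fls_poly_mult)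
    ultimately show "u + v \<in> ?L" "u * v \<in> ?L" by blast+
  next
    fix u assume u: "u \<in> ?L"
    then obtain f g where *: "fls_poly g r \<noteq> 0" "u * fls_poly g r = fls_poly f r" by blast
    have "- u * fls_poly g r = fls_poly (smult (-1) f) r" using * fls_poly_smult[of "- 1" f r] by simp
    then show "- u \<in> ?L" using * by blast
    show "inverse u \<in> ?L"
    \<comment> \<open>The numerator of 0 cannot serve as a denominator, but
      \<open>inverse 0 = 0\<close>.\<close>
    proof (cases "u = 0")
      case False
      then have "fls_poly f r \<noteq> 0" "inverse u * fls_poly f r = fls_poly g r"
        using * by (auto simp flip: *(2))
      then show ?thesis by blast
    qed (use u in simp)
  qed
  moreover have "constants \<union> {r} \<subseteq> ?L"
  proof -
    have "fls_const c \<in> ?L" for c by (intro CollectI exI[of _ "[:c:]"] exI[of _ 1]) simp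
    moreover have "r \<in> ?L" by (intro CollectI exI[of _ "[:0, 1:]"] exI[of _ 1]) simp
    ultimately show ?thesis by (auto simp: constants_def)
  qed
  ultimately show ?thesis using adjoin_minimal assms by blast
qed

lemma adjoin_common_denominator:
  fixes n :: nat
  assumes "\<And>j. u j \<in> adjoin constants {r}"
  shows "\<exists>g. fls_poly g r \<noteq> 0 \<and> (\<forall>j<n. \<exists>f. u j * fls_poly g r = fls_poly f r)"
proof (induction n)
  case 0
  show ?case by (auto intro!: exI[of _ 1])
next
  case (Suc n)
  then obtain g where g: "fls_poly g r \<noteq> 0" "\<And>j. j < n \<Longrightarrow> \<exists>f. u j * fls_poly g r = fls_poly f r"
    by blast
  obtain f' g' where g': "fls_poly g' r \<noteq> 0" "u n * fls_poly g' r = fls_poly f' r"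
    using adjoin_fractions[OF assms] by blast
  have "\<exists>f. u j * fls_poly (g * g') r = fls_poly f r" if j: "j < Suc n" for j
  proof (cases "j = n")
    case True
    then have "u j * fls_poly (g * g') r = fls_poly (g * f') r"
      by (simp add: fls_poly_mult flip: g'(2))
    then show ?thesis by blast
  next
    case False
    then obtain f where "u j * fls_poly g r = fls_poly f r" using j g(2)[of j] by auto
    then have "u j * fls_poly (g * g') r = fls_poly (f * g') r"
      by (simp add: fls_poly_mult flip: mult.assoc)
    then show ?thesis by blast
  qed
  moreover have "fls_poly (g * g') r \<noteq> 0" using g g' by (simp add: fls_poly_mult)
  ultimately show ?case by blast
qed

text \<open>A common denominator turns the coefficients of a polynomial for \<open>z\<close> into
  polynomials in \<open>r\<close> over \<open>F\<close>. Degree below \<open>B\<close> in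
  \<open>r\<close> and below \<open>n\<close> in \<open>z\<close> gives the total bound
  \<open>B + n\<close>.\<close>

lemma algebraic_bipoly_relation:
  fixes r z :: "'a::field fls"
  assumes "algebraic_over (adjoin constants {r}) z"
  obtains c D i j where "total_degree_less c D" "c i j \<noteq> (0::'a)" "bipoly c D r z = 0"
proof -
  obtain p where p: "p \<noteq> 0" "\<And>i. coeff p i \<in> adjoin constants {r}" "poly p z = 0"
    using assms by (auto simp: algebraic_over_def)
  define n where "n = Suc (degree p)"
  obtain g where g: "fls_poly g r \<noteq> 0" "\<And>j. j < n \<Longrightarrow> \<exists>f. coeff p j * fls_poly g r = fls_poly f r"
    using adjoin_common_denominator[of "coeff p" r n] p(2) by blast
  then obtain f where f: "\<And>j. j < n \<Longrightarrow> coeff p j * fls_poly g r = fls_poly (f j) r" by metis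
  define B where "B = Suc (Max (degree ` f ` {..<n}))"
  have B: "degree (f j) < B" if "j < n" for j
    using that unfolding B_def by (intro le_imp_less_Suc Max_ge) auto
  define c where "c i j = (if j < n then coeff (f j) i else 0)" for i j
  have "total_degree_less c (B + n)"
    unfolding total_degree_less_def
  proof (intro allI impI)
    fix i j assume "c i j \<noteq> 0"
    then have "j < n" "i \<le> degree (f j)" by (auto simp: c_def le_degree split: if_splits)
    then show "i + j < B + n" using B[of j] by simp
  qed
  moreover have "bipoly c (B + n) r z = 0"
  proof -
    have "bipoly c (B + n) r z = (\<Sum>j<B + n. (\<Sum>i<B + n. fls_const (c i j) * r ^ i) * z ^ j)"
      unfolding bipoly_def by (subst sum.swap) (simp add: sum_distrib_right)
    also have "\<dots> = (\<Sum>j<n. (\<Sum>i<B + n. fls_const (c i j) * r ^ i) * z ^ j)"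
      by (rule sum.mono_neutral_right) (auto simp: c_def)
    also have "\<dots> = (\<Sum>j<n. coeff p j * fls_poly g r * z ^ j)"
    proof (intro sum.cong refl arg_cong[of _ _ "\<lambda>x. x * _"])
      fix j assume "j \<in> {..<n}"
      then show "(\<Sum>i<B + n. fls_const (c i j) * r ^ i) = coeff p j * fls_poly g r"
        using B[of j] by (simp add: f fls_poly_altdef[of "f j" "B + n"] c_def)
    qed
    also have "\<dots> = fls_poly g r * poly p z"
      unfolding poly_altdef n_def lessThan_Suc_atMost by (simp add: sum_distrib_left mult_ac)
    finally show ?thesis by (simp add: p(3))
  qed
  \<comment> \<open>The leading coefficient of \<open>p\<close> times the nonzero denominator is
    nonzero, so its numerator \<open>f (degree p)\<close> is not the zero polynomial.\<close>
  moreover have "\<exists>i. c i (degree p) \<noteq> 0"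
  proof (rule ccontr)
    assume "\<not> ?thesis"
    then have "f (degree p) = 0" by (auto simp: c_def n_def intro: poly_eqI)
    then have "lead_coeff p * fls_poly g r = 0" using f[of "degree p"] by (simp add: n_def)
    then show False using p(1) g(1) by simp
  qed
  ultimately show thesis using that by blast
qed

lemma algebraically_independent_nonconstant:
  assumes "algebraically_independent constants {y}"
  shows "y \<notin> constants"
proof
  assume y: "y \<in> constants"
  define m where "m = Poly_Mapping.single y (1::nat)"
  \<comment> \<open>The polynomial \<open>T - y\<close> in the variable \<open>T\<close> named
    \<open>y\<close>; it vanishes at \<open>y\<close>, and its coefficients are constants if
    \<open>y\<close> is one.\<close>
  define p where "p = Poly_Mapping.single m (1::'a fls) - Poly_Mapping.single 0 y"
  have m0: "m \<noteq> 0" unfolding m_def by (metis lookup_single_eq lookup_zero one_neq_zero)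
  have lookup: "Poly_Mapping.lookup p k = (if k = m then 1 else if k = 0 then - y else 0)" for k
    using m0 by (auto simp: p_def lookup_minus lookup_single when_def)
  have keys: "Poly_Mapping.keys p \<subseteq> {m, 0}"
    by (auto simp: in_keys_iff lookup split: if_splits)
  have one: "(1::'a fls) \<in> constants" "(0::'a fls) \<in> constants" "- y \<in> constants"
    using y by (auto simp: constants_def image_iff intro: exI[of _ 1] exI[of _ 0])
      (metis fls_const_uminus)
  have "mpoly_eval p = (\<Sum>k\<in>{m, 0}. Poly_Mapping.lookup p k *
     (\<Prod>x\<in>Poly_Mapping.keys k. x ^ Poly_Mapping.lookup k x))"
    unfolding mpoly_eval_def using keys by (intro sum.mono_neutral_left) (auto simp: in_keys_iff)
  also have "\<dots> = 0" using m0 by (simp add: lookup) (simp add: m_def)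
  finally have "mpoly_eval p = 0" .
  moreover have "Poly_Mapping.keys k \<subseteq> {y}" if "k \<in> Poly_Mapping.keys p" for k
    using that keys by (auto simp: m_def)
  moreover have "Poly_Mapping.lookup p k \<in> constants" for k using one by (simp add: lookup)
  ultimately have "p = 0" using assms by (auto simp: algebraically_independent_def)
  then show False using lookup[of m] by simp
qed

text \<open>
  \<open>r\<close> is a root of the transcendence basis element, and need not lie in \<open>F(a)\<close>.
\<close>

lemma transcendence_degree_1_separating:
  fixes a :: "'a::field fls list"
  assumes perf: "perfect_field TYPE('a)" and "has_transcendence_degree constants (set a) 1"
  obtains r c D where "fls_deriv r \<noteq> 0"
    "\<And>j. j < length a \<Longrightarrow> total_degree_less (c j) (D j) \<and> bipoly (c j) (D j) r (a ! j) = 0 \<and>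
       bipoly (deriv2 (c j)) (D j) r (a ! j) \<noteq> 0"
proof -
  obtain y where y: "algebraically_independent constants {y}"
      "\<And>x. x \<in> adjoin constants (set a) \<Longrightarrow> algebraic_over (adjoin constants {y}) x"
    using assms(2) by (auto simp: has_transcendence_degree_def card_1_singleton_iff)
  obtain r q where r: "y = r ^ q" "fls_deriv r \<noteq> 0"
    using nonconstant_eq_power_of_separable[OF perf algebraically_independent_nonconstant[OF y(1)]]
    by blast
  have "r ^ m \<in> adjoin constants {r}" for m
  proof (induction m)
    case 0
    have "1 \<in> adjoin constants {r}" using is_subfield_adjoin by (auto simp: is_subfield_def)
    then show ?case by simp
  next
    case (Suc m)
    have "r \<in> adjoin constants {r}" using subset_adjoin by blast
    then show ?case using Suc is_subfield_adjoin[of constants "{r}"] by (auto simp: is_subfield_def)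
  qed
  then have "adjoin constants {y} \<subseteq> adjoin constants {r}"
    using is_subfield_adjoin subset_adjoin[of constants "{r}"] r(1) by (intro adjoin_minimal) auto
  then have alg: "algebraic_over (adjoin constants {r}) x" if "x \<in> set a" for x
  proof -
    have "x \<in> adjoin constants (set a)" using that subset_adjoin by blast
    from y(2)[OF this] obtain p where "p \<noteq> 0" "\<And>i. coeff p i \<in> adjoin constants {y}" "poly p x = 0"
      by (auto simp: algebraic_over_def)
    then show ?thesis using \<open>adjoin constants {y} \<subseteq> adjoin constants {r}\<close>
      unfolding algebraic_over_def by blast
  qed
  have "\<exists>c D. total_degree_less c D \<and> bipoly c D r (a ! j) = 0 \<and> bipoly (deriv2 c) D r (a ! j) \<noteq> 0"
    if j: "j < length a" for j
  proof -
    obtain c D i k where "total_degree_less c D" "c i k \<noteq> (0::'a)" "bipoly c D r (a ! j) = 0"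
      using algebraic_bipoly_relation[OF alg[OF nth_mem[OF j]]] .
    then show ?thesis using separable_relation[OF perf r(2)] by blast
  qed
  then obtain c D where "\<And>j. j < length a \<Longrightarrow> total_degree_less (c j) (D j) \<and>
      bipoly (c j) (D j) r (a ! j) = 0 \<and> bipoly (deriv2 (c j)) (D j) r (a ! j) \<noteq> 0"
    by metis
  then show thesis by (rule that[OF r(2)])
qed

section \<open>Automorphisms and orbits\<close>

lemma automorphismD:
  assumes "\<sigma> \<in> valued_field_automorphisms"
  shows "bij \<sigma>" "\<sigma> (x + y) = \<sigma> x + \<sigma> y" "\<sigma> (x * y) = \<sigma> x * \<sigma> y" "\<sigma> (fls_const k) = fls_const k"
    "\<sigma> x \<in> power_series \<longleftrightarrow> x \<in> power_series" "\<sigma> 0 = 0" "\<sigma> 1 = 1" "\<sigma> (x ^ n) = \<sigma> x ^ n"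
    "\<sigma> (\<Sum>i\<in>A. f i) = (\<Sum>i\<in>A. \<sigma> (f i))"
proof -
  show *: "bij \<sigma>" "\<And>x y. \<sigma> (x + y) = \<sigma> x + \<sigma> y" "\<And>x y. \<sigma> (x * y) = \<sigma> x * \<sigma> y"
     "\<And>k. \<sigma> (fls_const k) = fls_const k"
    using assms by (auto simp: valued_field_automorphisms_def constants_def)
  have "\<sigma> ` power_series = power_series" using assms by (auto simp: valued_field_automorphisms_def)
  then show "\<sigma> x \<in> power_series \<longleftrightarrow> x \<in> power_series"
    using *(1) by (metis bij_is_inj inj_image_mem_iff)
  show zero: "\<sigma> 0 = 0" and one: "\<sigma> 1 = 1" using *(4)[of 0] *(4)[of 1] by simp_all
  show "\<sigma> (x ^ n) = \<sigma> x ^ n" by (induction n) (simp_all add: * one)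
  show "\<sigma> (\<Sum>i\<in>A. f i) = (\<Sum>i\<in>A. \<sigma> (f i))"
    by (induction A rule: infinite_finite_induct) (simp_all add: * zero)
qed

lemma automorphism_comp:
  assumes "\<sigma> \<in> valued_field_automorphisms" "\<tau> \<in> valued_field_automorphisms"
  shows "\<sigma> \<circ> \<tau> \<in> valued_field_automorphisms"
proof -
  have "(\<sigma> \<circ> \<tau>) ` power_series = power_series"
    using assms by (simp only: image_comp[symmetric] valued_field_automorphisms_def mem_Collect_eq)
  then show ?thesis using assms by (simp add: valued_field_automorphisms_def bij_comp)
qed

lemma automorphism_inv:
  assumes s: "\<sigma> \<in> valued_field_automorphisms"
  shows "inv \<sigma> \<in> valued_field_automorphisms"
proof -
  note d = automorphismD[OF s]
  have si: "\<sigma> (inv \<sigma> x) = x" "inv \<sigma> (\<sigma> x) = x" for x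
    using d(1) by (auto simp: bij_is_inj bij_is_surj surj_f_inv_f)
  have "inv \<sigma> (x + y) = inv \<sigma> x + inv \<sigma> y" "inv \<sigma> (x * y) = inv \<sigma> x * inv \<sigma> y" for x y
    using si(2)[of "inv \<sigma> x + inv \<sigma> y"] si(2)[of "inv \<sigma> x * inv \<sigma> y"] by (simp_all add: d(2,3) si(1))
  moreover have "inv \<sigma> ` power_series = power_series"
  proof (intro equalityI subsetI)
    show "x \<in> inv \<sigma> ` power_series" if "x \<in> power_series" for x
      using that d(5)[of x] si(2)[of x] by (intro image_eqI[of _ _ "\<sigma> x"]) simp_all
    show "x \<in> power_series" if "x \<in> inv \<sigma> ` power_series" for x
    proof -
      from that obtain y where "y \<in> power_series" "x = inv \<sigma> y" by blast
      then show ?thesis using d(5)[of "inv \<sigma> y"] by (simp only: si(1))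
    qed
  qed
  moreover have "inv \<sigma> c = c" if "c \<in> constants" for c
  proof -
    have "\<sigma> c = c" using that s by (simp add: valued_field_automorphisms_def)
    then show ?thesis using si(2)[of c] by simp
  qed
  ultimately show ?thesis using bij_imp_bij_inv[OF d(1)] by (simp add: valued_field_automorphisms_def)
qed

lemma automorphism_bipoly:
  assumes "\<sigma> \<in> valued_field_automorphisms"
  shows "\<sigma> (bipoly c D x y) = bipoly c D (\<sigma> x) (\<sigma> y)"
  by (simp add: bipoly_def automorphismD[OF assms])

text \<open>
  The factor \<open>s\<^sup>M\<close> clears the poles, so that the condition is a polynomial equation in \<open>x\<close>, \<open>s\<close>
  and \<open>u\<close> over \<open>F\<close>.
\<close>

definition near_truncation :: "'a::field fls \<Rightarrow> nat \<Rightarrow> 'a fls \<Rightarrow> 'a fls \<Rightarrow> bool" where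
  "near_truncation b N s x \<longleftrightarrow> (let M = nat (- fls_subdegree b) in
     \<exists>u\<in>power_series. x * s ^ M
       = (\<Sum>i<M + N. fls_const (b $$ (int i - int M)) * s ^ i) + u * s ^ (M + N))"

text \<open>The coefficients of \<open>b\<close> enter as constants and \<open>M\<close> is a
  number, so only \<open>s\<close>, \<open>x\<close> and \<open>u\<close> move, and \<open>u\<close>
  stays in the valuation ring.\<close>

lemma automorphism_near_truncation:
  assumes s: "\<sigma> \<in> valued_field_automorphisms" and near: "near_truncation b N s x"
  shows "near_truncation b N (\<sigma> s) (\<sigma> x)"
proof -
  define M where "M = nat (- fls_subdegree b)"
  obtain u where u: "u \<in> power_series" "x * s ^ M
       = (\<Sum>i<M + N. fls_const (b $$ (int i - int M)) * s ^ i) + u * s ^ (M + N)"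
    using near by (auto simp: near_truncation_def Let_def M_def)
  have "\<sigma> x * \<sigma> s ^ M
       = (\<Sum>i<M + N. fls_const (b $$ (int i - int M)) * \<sigma> s ^ i) + \<sigma> u * \<sigma> s ^ (M + N)"
    using arg_cong[OF u(2), of \<sigma>] by (simp add: automorphismD[OF s])
  then show ?thesis using u(1) automorphismD(5)[OF s]
    unfolding near_truncation_def Let_def M_def by blast
qed

text \<open>For \<open>s = fls_X\<close> the sum is \<open>fls_X ^ M\<close> times \<open>b\<close>
  cut off at exponent \<open>N\<close>, and \<open>u\<close> absorbs the rest. Other uniformisers
  are reduced to this case by an automorphism.\<close>

lemma near_truncation_X: "near_truncation b N fls_X x \<longleftrightarrow> x - b \<in> fls_val_ge (int N)"
proof -
  define M where "M = nat (- fls_subdegree b)"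
  define T where "T = (\<Sum>i<M + N. fls_const (b $$ (int i - int M)) * fls_X ^ i)"
  have T: "T $$ n = (if 0 \<le> n \<and> n < int (M + N) then b $$ (n - int M) else 0)" for n
  proof -
    have "T $$ n = (\<Sum>i<M + N. if n = int i then b $$ (int i - int M) else 0)"
      unfolding T_def fls_nth_sum
      by (intro sum.cong) (auto simp: fls_X_power_times_conv_shift)
    also have "\<dots> = (\<Sum>i<M + N. if i = nat n \<and> 0 \<le> n then b $$ (n - int M) else 0)"
      by (intro sum.cong) auto
    also have "\<dots> = (if 0 \<le> n \<and> n < int (M + N) then b $$ (n - int M) else 0)"
      by (cases "0 \<le> n") (auto simp: nat_less_iff)
    finally show ?thesis .
  qed
  have M: "b $$ n = 0" if "n < - int M" for n
    using that by (intro fls_eq0_below_subdegree) (simp add: M_def split: if_splits)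
  have "(\<exists>u\<in>power_series. x * fls_X ^ M = T + u * fls_X ^ (M + N))
      \<longleftrightarrow> x * fls_X ^ M - T \<in> fls_val_ge (int (M + N))"
  proof
    assume "x * fls_X ^ M - T \<in> fls_val_ge (int (M + N))"
    then have "fls_shift (int (M + N)) (x * fls_X ^ M - T) \<in> power_series"
      by (auto simp: power_series_eq fls_val_ge_def)
    moreover have "fls_shift (int (M + N)) y * fls_X ^ (M + N) = y" for y :: "'a fls"
      by (simp add: fls_X_power_times_conv_shift)
    from this[of "x * fls_X ^ M - T"]
    have "x * fls_X ^ M = T + fls_shift (int (M + N)) (x * fls_X ^ M - T) * fls_X ^ (M + N)"
      by (simp only: add_diff_cancel_left' diff_add_cancel add.commute[of T])
    ultimately show "\<exists>u\<in>power_series. x * fls_X ^ M = T + u * fls_X ^ (M + N)" by blast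
  next
    assume "\<exists>u\<in>power_series. x * fls_X ^ M = T + u * fls_X ^ (M + N)"
    then obtain u where u: "u \<in> power_series" "x * fls_X ^ M - T = u * fls_X ^ (M + N)" by auto
    show "x * fls_X ^ M - T \<in> fls_val_ge (int (M + N))"
      unfolding u(2) using u(1) by (auto simp: power_series_eq fls_val_ge_def fls_X_power_times_conv_shift)
  qed
  also have "\<dots> \<longleftrightarrow> x - b \<in> fls_val_ge (int N)"
  proof -
    have shift: "(x * fls_X ^ M - T) $$ n = (x - b) $$ (n - int M)" if "n < int (M + N)" for n
      using that M[of "n - int M"] by (auto simp: T fls_X_power_times_conv_shift)
    show ?thesis unfolding fls_val_ge_def mem_Collect_eq
    proof safe
      fix i assume *: "\<forall>i<int (M + N). (x * fls_X ^ M - T) $$ i = 0" "i < int N"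
      then have "i + int M < int (M + N)" by simp
      then show "(x - b) $$ i = 0" using shift[of "i + int M"] * by (simp del: fls_minus_nth)
    next
      fix i assume *: "\<forall>i<int N. (x - b) $$ i = 0" "i < int (M + N)"
      then have "i - int M < int N" by simp
      then show "(x * fls_X ^ M - T) $$ i = 0" using shift[OF *(2)] *(1) by (simp del: fls_minus_nth)
    qed
  qed
  finally show ?thesis by (simp add: near_truncation_def Let_def T_def M_def)
qed

text \<open>The radii depend on each other in this order: \<open>N1\<close> isolates the roots,
  \<open>k1\<close> is how close \<open>s\<close> must be to \<open>fps_X\<close> for the
  substituted \<open>a ! j\<close> to stay within \<open>N1\<close>, and \<open>N2\<close> is how
  close \<open>x\<close> must be to \<open>r\<close> for such an \<open>s\<close> to exist.\<close>

lemma orbit_neighbourhood: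
  fixes a :: "'a::field fls list"
  assumes r: "fls_deriv r \<noteq> 0"
    and rel: "\<And>j. j < length a \<Longrightarrow> total_degree_less (c j) (D j) \<and> bipoly (c j) (D j) r (a ! j) = 0 \<and>
       bipoly (deriv2 (c j)) (D j) r (a ! j) \<noteq> 0"
  shows "\<exists>N::nat. \<forall>x b. x - r \<in> fls_val_ge N \<and> length b = length a \<and>
     (\<forall>j<length a. b ! j - a ! j \<in> fls_val_ge N \<and> bipoly (c j) (D j) x (b ! j) = 0) \<longrightarrow> b \<in> orbit a"
proof -
  have "\<exists>N::nat. \<forall>y z z'. y - r \<in> fls_val_ge N \<and> z - a ! j \<in> fls_val_ge N \<and> z' - a ! j \<in> fls_val_ge N \<and>
    bipoly (c j) (D j) y z = 0 \<and> bipoly (c j) (D j) y z' = 0 \<longrightarrow> z = z'" if "j < length a" for j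
    using bipoly_root_unique_near rel[OF that] by blast
  then obtain N where N: "\<And>j y z z'. j < length a \<Longrightarrow> y - r \<in> fls_val_ge (int (N j)) \<Longrightarrow>
    z - a ! j \<in> fls_val_ge (int (N j)) \<Longrightarrow> z' - a ! j \<in> fls_val_ge (int (N j)) \<Longrightarrow>
    bipoly (c j) (D j) y z = 0 \<Longrightarrow> bipoly (c j) (D j) y z' = 0 \<Longrightarrow> z = z'" by metis
  define N1 where "N1 = (\<Sum>j<length a. N j)"
  have N1: "N j \<le> N1" if "j < length a" for j
    unfolding N1_def using that by (intro member_le_sum) auto
  have "\<exists>k\<ge>2. \<forall>s. fps_X ^ k dvd s - fps_X \<longrightarrow> fls_compose_fps (a ! j) s - a ! j \<in> fls_val_ge (int N1)" for j
    by (rule fls_compose_near)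
  then obtain k where k: "\<And>j s. fps_X ^ k j dvd s - fps_X \<Longrightarrow>
    fls_compose_fps (a ! j) s - a ! j \<in> fls_val_ge (int N1)" by metis
  define k1 where "k1 = 2 + (\<Sum>j<length a. k j)"
  have k1: "k j \<le> k1" if "j < length a" for j
    unfolding k1_def using that by (intro trans_le_add2 member_le_sum) auto
  have k12: "2 \<le> k1" by (simp add: k1_def)
  obtain N2 where N2: "\<And>x. x - r \<in> fls_val_ge N2 \<Longrightarrow>
      \<exists>s. fps_X ^ k1 dvd s - fps_X \<and> fls_compose_fps r s = x"
    using fls_compose_solve[OF r k12] by blast
  define N3 where "N3 = N1 + nat N2"
  have "b \<in> orbit a" if x: "x - r \<in> fls_val_ge (int N3)" and len: "length b = length a"
    and b: "\<And>j. j < length a \<Longrightarrow> b ! j - a ! j \<in> fls_val_ge (int N3) \<and> bipoly (c j) (D j) x (b ! j) = 0"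
    for x b
  proof -
    have "x - r \<in> fls_val_ge N2" by (rule fls_val_ge_mono[OF x]) (simp add: N3_def)
    then obtain s where s: "fps_X ^ k1 dvd s - fps_X" "fls_compose_fps r s = x" using N2 by blast
    note us = uniformiser_of_near_X[OF s(1) k12]
    have aut: "(\<lambda>x. fls_compose_fps x s) \<in> valued_field_automorphisms"
      by (rule fls_compose_automorphism) (use us in simp_all)
    have "b ! j = fls_compose_fps (a ! j) s" if j: "j < length a" for j
    proof (rule N[OF j])
      show "x - r \<in> fls_val_ge (int (N j))" "b ! j - a ! j \<in> fls_val_ge (int (N j))"
        using x b[OF j] N1[OF j] by (auto elim!: fls_val_ge_mono simp: N3_def)
      have "fps_X ^ k j dvd s - fps_X" using s(1) k1[OF j] by (meson dvd_trans le_imp_power_dvd)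
      from k[OF this] show "fls_compose_fps (a ! j) s - a ! j \<in> fls_val_ge (int (N j))"
        by (rule fls_val_ge_mono) (simp add: N1[OF j])
      show "bipoly (c j) (D j) x (b ! j) = 0" using b[OF j] by simp
      show "bipoly (c j) (D j) x (fls_compose_fps (a ! j) s) = 0"
        using automorphism_bipoly[OF aut, of "c j" "D j" r "a ! j"] rel[OF j] by (simp add: s(2))
    qed
    then have "b = map (\<lambda>x. fls_compose_fps x s) a" using len by (auto intro: nth_equalityI)
    then show ?thesis using aut unfolding orbit_def by blast
  qed
  then show ?thesis by blast
qed

text \<open>Substituting \<open>s\<close> for \<open>fls_X\<close> is an automorphism
  \<open>\<sigma>\<close>. Its inverse turns closeness relative to \<open>s\<close> into closeness
  relative to \<open>fls_X\<close>, where the neighbourhood \<open>N\<close> applies; composing with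
  \<open>\<sigma>\<close> returns to \<open>b\<close>.\<close>

lemma orbit_contains:
  fixes a :: "'a::field fls list"
  assumes N: "\<forall>x b. x - r \<in> fls_val_ge (int N) \<and> length b = length a \<and>
     (\<forall>j<length a. b ! j - a ! j \<in> fls_val_ge (int N) \<and> bipoly (c j) (D j) x (b ! j) = 0) \<longrightarrow>
     b \<in> orbit a"
    and s: "fls_subdegree s = 1" and len: "length b = length a" and x: "near_truncation r N s x"
    and b: "\<And>j. j < length a \<Longrightarrow> near_truncation (a ! j) N s (b ! j) \<and> bipoly (c j) (D j) x (b ! j) = 0"
  shows "b \<in> orbit a"
proof -
  have "s \<in> power_series" using s by (auto simp: power_series_eq fls_val_ge_iff)
  then obtain S where S: "s = fps_to_fls S" by (auto simp: power_series_def)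
  have "subdegree S = 1" using s by (simp add: S fls_subdegree_fls_to_fps)
  then have S1: "S $ 0 = 0" "S $ 1 \<noteq> 0"
    by (metis less_one nth_less_subdegree_zero, metis nth_subdegree_nonzero subdegree_0 zero_neq_one)
  define \<sigma> where "\<sigma> x = fls_compose_fps x S" for x
  have \<sigma>: "\<sigma> \<in> valued_field_automorphisms"
    using fls_compose_automorphism[OF S1] by (simp add: \<sigma>_def[abs_def])
  note \<tau> = automorphism_inv[OF \<sigma>]
  have inv: "inv \<sigma> (\<sigma> x) = x" "\<sigma> (inv \<sigma> x) = x" for x
    using automorphismD(1)[OF \<sigma>] by (auto simp: bij_is_inj bij_is_surj surj_f_inv_f)
  have "\<sigma> fls_X = s" by (simp add: \<sigma>_def S)
  then have ts: "inv \<sigma> s = fls_X" using inv(1)[of fls_X] by simp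
  have "map (inv \<sigma>) b \<in> orbit a"
  proof (rule N[rule_format, of "inv \<sigma> x"], intro conjI allI impI)
    show "inv \<sigma> x - r \<in> fls_val_ge (int N)"
      using automorphism_near_truncation[OF \<tau> x] by (simp add: ts near_truncation_X)
    show "length (map (inv \<sigma>) b) = length a" by (simp add: len)
    fix j assume j: "j < length a"
    show "map (inv \<sigma>) b ! j - a ! j \<in> fls_val_ge (int N)"
      "bipoly (c j) (D j) (inv \<sigma> x) (map (inv \<sigma>) b ! j) = 0"
      using b[OF j] automorphism_near_truncation[OF \<tau>, of "a ! j" N s "b ! j"] j len
        automorphism_bipoly[OF \<tau>, of "c j" "D j" x "b ! j"] automorphismD(6)[OF \<tau>]
      by (simp_all add: ts near_truncation_X)
  qed
  then obtain \<rho> where \<rho>: "\<rho> \<in> valued_field_automorphisms" "map (inv \<sigma>) b = map \<rho> a"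
    by (auto simp: orbit_def)
  have "b = map \<sigma> (map (inv \<sigma>) b)" by (simp add: inv o_def)
  then have "b = map (\<sigma> \<circ> \<rho>) a" by (simp add: \<rho>(2))
  then show ?thesis using automorphism_comp[OF \<sigma> \<rho>(1)] unfolding orbit_def by blast
qed

section \<open>The valuation ring and the uniformisers\<close>

text \<open>With \<open>y = fps_X * z\<close> and \<open>h = fps_X * H'\<close> the equation becomes
  \<open>z = H' - fps_X * (z * z)\<close>, a contraction in every characteristic, 2
  included.\<close>

lemma artin_schreier_solvable:
  fixes h :: "'a::field fls"
  assumes "h \<in> fls_val_ge 1"
  shows "\<exists>y. y * y + y = h"
proof -
  have "h \<in> power_series" unfolding power_series_eq by (rule fls_val_ge_mono[OF assms]) simp
  then obtain H where H: "h = fps_to_fls H" by (auto simp: power_series_def)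
  then have "fps_X dvd H" using assms fps_to_fls_val_ge[of H 1] by simp
  then obtain H' where H': "H = fps_X * H'" by (auto simp: dvd_def)
  obtain z where z: "H' - fps_X * (z * z) = z"
  proof (rule fps_contraction_fixpoint[of "\<lambda>z. H' - fps_X * (z * z)"])
    fix n and z w :: "'a fps" assume "fps_X ^ n dvd z - w"
    moreover have "H' - fps_X * (z * z) - (H' - fps_X * (w * w)) = fps_X * ((z - w) * - (z + w))"
      by (simp add: algebra_simps)
    ultimately show "fps_X ^ Suc n dvd H' - fps_X * (z * z) - (H' - fps_X * (w * w))"
      by (simp only: power_Suc) (intro mult_dvd_mono dvd_mult2 dvd_refl)
  qed auto
  have "fps_X * z * (fps_X * z) + fps_X * z = H"
    by (subst (3) z[symmetric]) (simp add: H' algebra_simps)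
  then have "fps_to_fls (fps_X * z) * fps_to_fls (fps_X * z) + fps_to_fls (fps_X * z) = h"
    unfolding H by (metis fps_to_fls_plus fls_times_fps_to_fls)
  then show ?thesis by blast
qed

text \<open>Parity: for \<open>x\<close> of negative value the right side has odd negative value,
  which forces \<open>y\<close> to have negative value; then \<open>y * y + y\<close> has twice the
  value of \<open>y\<close>.\<close>

lemma artin_schreier_uniformiser:
  fixes s x :: "'a::field fls"
  assumes s: "fls_subdegree s = 1"
  shows "(\<exists>y. y * y + y = s * (x * x)) \<longleftrightarrow> x \<in> power_series"
proof
  assume "x \<in> power_series"
  then have "s * (x * x) \<in> fls_val_ge (1 + (0 + 0))"
    unfolding power_series_eq by (intro fls_val_ge_mult) (simp_all add: fls_val_ge_iff s)
  then show "\<exists>y. y * y + y = s * (x * x)" by (intro artin_schreier_solvable) simp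
next
  assume "\<exists>y. y * y + y = s * (x * x)"
  then obtain y where y: "y * y + y = s * (x * x)" by blast
  show "x \<in> power_series"
  proof (rule ccontr)
    assume "x \<notin> power_series"
    then have x: "x \<noteq> 0" "fls_subdegree x < 0" by (auto simp: power_series_eq fls_val_ge_iff)
    have s0: "s \<noteq> 0" using s by auto
    have deg: "fls_subdegree (s * (x * x)) = 1 + 2 * fls_subdegree x" using x s s0 by simp
    then have neg: "fls_subdegree (y * y + y) < 0" using x unfolding y by simp
    have "y \<notin> fls_val_ge 0"
    proof
      assume "y \<in> fls_val_ge 0"
      then have "y * y + y \<in> fls_val_ge 0"
        using fls_val_ge_mult[of y 0 y 0] by (auto intro: fls_val_ge_add)
      then show False using neg by (auto simp: fls_val_ge_iff)
    qed
    then have y': "y \<noteq> 0" "fls_subdegree y < 0" by (auto simp: fls_val_ge_iff)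
    have "fls_subdegree (y * y + y) = fls_subdegree (y * y)"
      using y' by (intro fls_subdegree_add_eq1) auto
    then have "2 * fls_subdegree y = 1 + 2 * fls_subdegree x" using deg y y' by simp
    then show False by presburger
  qed
qed

text \<open>
  For a uniformiser \<open>s\<close> the set of all \<open>x\<close> such that \<open>s x\<^sup>2\<close> is of the form \<open>y\<^sup>2 + y\<close> is the
  valuation ring.  For every \<open>s \<noteq> 0\<close> it contains a nonzero fractional ideal, so
  if it is closed under multiplication and contains an element of negative value, it is everything.
\<close>

lemma power_series_parameter_free:
  fixes x :: "'a::field fls"
  shows "x \<in> power_series \<longleftrightarrow> (\<exists>s. (\<exists>y. y * y + y = s * (x * x)) \<and>
      (\<exists>w. \<not> (\<exists>y. y * y + y = s * (w * w))) \<and>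
      (\<forall>u v. (\<exists>y. y * y + y = s * (u * u)) \<and> (\<exists>y. y * y + y = s * (v * v)) \<longrightarrow>
        (\<exists>y. y * y + y = s * ((u * v) * (u * v)))))"
proof
  assume x: "x \<in> power_series"
  have X: "fls_subdegree (fls_X :: 'a fls) = 1" by simp
  have inv: "fls_X_inv \<notin> (power_series :: 'a fls set)" by (simp add: power_series_eq fls_val_ge_iff)
  have mult: "u * v \<in> power_series" if "u \<in> power_series" "v \<in> power_series" for u v :: "'a fls"
    using that fls_val_ge_mult[of u 0 v 0] by (simp add: power_series_eq)
  show "\<exists>s. (\<exists>y. y * y + y = s * (x * x)) \<and>
      (\<exists>w. \<not> (\<exists>y. y * y + y = s * (w * w))) \<and>
      (\<forall>u v. (\<exists>y. y * y + y = s * (u * u)) \<and> (\<exists>y. y * y + y = s * (v * v)) \<longrightarrow>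
        (\<exists>y. y * y + y = s * ((u * v) * (u * v))))"
    by (intro exI[of _ "fls_X :: 'a fls"], unfold artin_schreier_uniformiser[OF X])
      (use x inv mult in blast)
next
  let ?R = "\<lambda>s x. \<exists>y. y * y + y = s * (x * x)"
  assume "\<exists>s. ?R s x \<and> (\<exists>w. \<not> ?R s w) \<and> (\<forall>u v. ?R s u \<and> ?R s v \<longrightarrow> ?R s (u * v))"
  then obtain s w where s: "?R s x" "\<not> ?R s w" "\<And>u v. ?R s u \<Longrightarrow> ?R s v \<Longrightarrow> ?R s (u * v)"
    by blast
  show "x \<in> power_series"
  proof (rule ccontr)
    assume "x \<notin> power_series"
    then have x: "x \<noteq> 0" "fls_subdegree x < 0" by (auto simp: power_series_eq fls_val_ge_iff)
    \<comment> \<open>So the set has elements of arbitrarily negative value.\<close>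
    have pow: "?R s (x ^ Suc k)" for k
      by (induction k) (use s(1) s(3)[of x] in \<open>simp_all only: power_Suc power_0 mult_1_right\<close>)
    define m where "m = 1 + \<bar>fls_subdegree s\<bar>"
    have small: "?R s z" if z: "z \<in> fls_val_ge m" for z
    proof (rule artin_schreier_solvable)
      have "s \<in> fls_val_ge (fls_subdegree s)" by (simp add: fls_val_ge_iff)
      then have "s * (z * z) \<in> fls_val_ge (fls_subdegree s + (m + m))"
        by (intro fls_val_ge_mult z)
      then show "s * (z * z) \<in> fls_val_ge 1" by (rule fls_val_ge_mono) (simp add: m_def)
    qed
    \<comment> \<open>As \<open>x\<close> has value at most -1, dividing \<open>w\<close> by
      \<open>x ^ Suc k\<close> raises the value to at least \<open>m\<close>; so \<open>w\<close> is
      a product of two members.\<close>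
    define k where "k = nat (m - fls_subdegree w)"
    define z where "z = w / x ^ Suc k"
    have "z \<in> fls_val_ge m"
    proof (cases "w = 0")
      case False
      define t where "t = int (Suc k) * fls_subdegree x"
      have "t \<le> int (Suc k) * (- 1)"
        unfolding t_def using x by (intro mult_left_mono) auto
      then have "m \<le> fls_subdegree w - t" by (simp add: k_def split: if_splits)
      moreover have "fls_subdegree z = fls_subdegree w - t"
        unfolding z_def t_def using False x
        by (subst fls_divide_subdegree) (simp_all add: fls_subdegree_pow del: power_Suc)
      ultimately show ?thesis by (simp add: fls_val_ge_iff)
    qed (simp add: z_def)
    then have "?R s (x ^ Suc k * z)" by (intro s(3) pow small)
    moreover have "x ^ Suc k * z = w" using x by (simp add: z_def)
    ultimately show False using s(2) by simp
  qed
qed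

text \<open>That \<open>y * x = 1\<close> for some \<open>y\<close> in the valuation ring means that
  \<open>x\<close> is nonzero of value at most 0. The last clause excludes \<open>s = 0\<close> and,
  taken at \<open>w = fls_X_inv\<close>, bounds the value of \<open>s\<close> by 1.\<close>

lemma uniformiser_iff:
  fixes s :: "'a::field fls"
  shows "fls_subdegree s = 1 \<longleftrightarrow> s \<in> power_series \<and> \<not> (\<exists>z. z \<in> power_series \<and> z * s = 1) \<and>
     \<not> (\<exists>w. w \<notin> power_series \<and> \<not> (\<exists>y. y \<in> power_series \<and> y * (s * w) = 1))"
proof -
  have div: "(\<exists>y. y \<in> power_series \<and> y * x = 1) \<longleftrightarrow> x \<noteq> 0 \<and> fls_subdegree x \<le> 0" for x :: "'a fls"
  proof
    assume "\<exists>y. y \<in> power_series \<and> y * x = 1"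
    then obtain y where y: "y \<in> power_series" "y * x = 1" by blast
    then have "y \<noteq> 0" "x \<noteq> 0" by auto
    then have "fls_subdegree y + fls_subdegree x = 0" using arg_cong[OF y(2), of fls_subdegree] by simp
    then show "x \<noteq> 0 \<and> fls_subdegree x \<le> 0" using y \<open>y \<noteq> 0\<close> \<open>x \<noteq> 0\<close>
      by (auto simp: power_series_eq fls_val_ge_iff)
  next
    assume "x \<noteq> 0 \<and> fls_subdegree x \<le> 0"
    then show "\<exists>y. y \<in> power_series \<and> y * x = 1"
      by (intro exI[of _ "inverse x"]) (simp add: power_series_eq fls_val_ge_iff)
  qed
  have ps: "x \<in> power_series \<longleftrightarrow> x = 0 \<or> 0 \<le> fls_subdegree x" for x :: "'a fls"
    by (simp add: power_series_eq fls_val_ge_iff)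
  show ?thesis
    unfolding div unfolding ps
  proof
    assume s: "fls_subdegree s = 1"
    then have "s \<noteq> 0" by auto
    then show "(s = 0 \<or> 0 \<le> fls_subdegree s) \<and> \<not> (s \<noteq> 0 \<and> fls_subdegree s \<le> 0) \<and>
      \<not> (\<exists>w. \<not> (w = 0 \<or> 0 \<le> fls_subdegree w) \<and> \<not> (s * w \<noteq> 0 \<and> fls_subdegree (s * w) \<le> 0))"
      using s by auto
  next
    assume *: "(s = 0 \<or> 0 \<le> fls_subdegree s) \<and> \<not> (s \<noteq> 0 \<and> fls_subdegree s \<le> 0) \<and>
      \<not> (\<exists>w. \<not> (w = 0 \<or> 0 \<le> fls_subdegree w) \<and> \<not> (s * w \<noteq> 0 \<and> fls_subdegree (s * w) \<le> 0))"
    moreover have "\<not> (fls_X_inv = (0::'a fls) \<or> 0 \<le> fls_subdegree (fls_X_inv :: 'a fls))" by simp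
    ultimately have s: "s \<noteq> 0" "fls_subdegree (s * fls_X_inv) \<le> 0" by (metis mult_zero_left)+
    then show "fls_subdegree s = 1" using * fls_subdegree_mult[OF s(1) fls_X_inv_nonzero] by auto
  qed
qed

text \<open>With \<open>fls_X\<close> as a parameter, being associated to \<open>fls_X\<close> in
  the valuation ring takes no negation, as the existential formula requires.\<close>

lemma uniformiser_iff_X:
  fixes s :: "'a::field fls"
  shows "fls_subdegree s = 1 \<longleftrightarrow>
    (\<exists>u. u \<in> power_series \<and> s = fls_X * u) \<and> (\<exists>u. u \<in> power_series \<and> fls_X = s * u)"
proof safe
  assume s: "fls_subdegree s = 1"
  then have s0: "s \<noteq> 0" by auto
  show "\<exists>u. u \<in> power_series \<and> s = fls_X * u"
    by (intro exI[of _ "s / fls_X"])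
      (simp add: power_series_eq fls_val_ge_iff fls_divide_subdegree s s0 del: fls_divide_X)
  show "\<exists>u. u \<in> power_series \<and> fls_X = s * u"
    by (intro exI[of _ "fls_X / s"]) (simp add: power_series_eq fls_val_ge_iff fls_divide_subdegree s s0)
next
  fix u u' :: "'a fls"
  assume u: "u \<in> power_series" "u' \<in> power_series" "fls_X = fls_X * u * u'"
  then have "u \<noteq> 0" "u' \<noteq> 0" by auto
  moreover have "1 = u * u'" using u(3) by simp
  then have "fls_subdegree (u * u') = 0" by (metis fls_one_subdegree)
  ultimately show "fls_subdegree (fls_X * u) = 1"
    using u by (auto simp: power_series_eq fls_val_ge_iff)
qed

section \<open>Definable predicates\<close>

lemma tm_val_automorphism:
  assumes s: "\<sigma> \<in> valued_field_automorphisms" and "tm_params u \<subseteq> constants"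
  shows "tm_val (\<sigma> \<circ> e) u = \<sigma> (tm_val e u)"
  using assms(2) by (induction u) (auto simp: automorphismD[OF s] constants_def)

lemma sat_automorphism:
  assumes s: "\<sigma> \<in> valued_field_automorphisms" and "params f \<subseteq> constants"
  shows "sat power_series (\<sigma> \<circ> e) f \<longleftrightarrow> sat power_series e f"
  using assms(2)
proof (induction f arbitrary: e)
  case (Eq u w)
  then have "tm_params u \<subseteq> constants" "tm_params w \<subseteq> constants" by simp_all
  then show ?case
    by (simp only: sat.simps tm_val_automorphism[OF s] inj_eq[OF bij_is_inj[OF automorphismD(1)[OF s]]])
next
  case (InO u)
  then have "tm_params u \<subseteq> constants" by simp
  then show ?case by (simp only: sat.simps tm_val_automorphism[OF s] automorphismD(5)[OF s])
next
  case (Ex i f)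
  \<comment> \<open>The quantifier ranges over the whole field, so this case rests on the
    surjectivity of \<open>\<sigma>\<close>.\<close>
  have surj: "(\<exists>x. Q x) \<longleftrightarrow> (\<exists>x. Q (\<sigma> x))" for Q
    using automorphismD(1)[OF s] by (metis bij_pointE)
  have "sat power_series (\<sigma> \<circ> e) (Ex i f) \<longleftrightarrow> (\<exists>x. sat power_series ((\<sigma> \<circ> e)(i := \<sigma> x)) f)"
    unfolding sat.simps by (rule surj)
  also have "\<dots> \<longleftrightarrow> (\<exists>x. sat power_series (\<sigma> \<circ> e(i := x)) f)"
    by (simp only: fun_upd_comp)
  also have "\<dots> \<longleftrightarrow> sat power_series e (Ex i f)"
  proof -
    have "params f \<subseteq> constants" using Ex.prems by simp
    then show ?thesis by (simp only: sat.simps Ex.IH)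
  qed
  finally show ?case .
qed simp_all

lemma tm_val_cong: "(\<And>i. i \<in> tm_vars u \<Longrightarrow> e i = e' i) \<Longrightarrow> tm_val e u = tm_val e' u"
proof (induction u)
  case (Add u w)
  then have "tm_val e u = tm_val e' u" "tm_val e w = tm_val e' w" by simp_all
  then show ?case by simp
next
  case (Mul u w)
  then have "tm_val e u = tm_val e' u" "tm_val e w = tm_val e' w" by simp_all
  then show ?case by simp
qed simp_all

lemma sat_cong: "(\<And>i. i \<in> free_vars f \<Longrightarrow> e i = e' i) \<Longrightarrow> sat V e f \<longleftrightarrow> sat V e' f"
proof (induction f arbitrary: e e')
  case (Eq u w)
  have "tm_val e u = tm_val e' u" "tm_val e w = tm_val e' w"
    by (rule tm_val_cong, rule Eq, simp)+
  then show ?case by simp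
next
  case (InO u)
  have "tm_val e u = tm_val e' u" by (rule tm_val_cong, rule InO, simp)
  then show ?case by simp
next
  case (Neg f)
  have "sat V e f \<longleftrightarrow> sat V e' f" by (rule Neg.IH, rule Neg.prems, simp)
  then show ?case by simp
next
  case (Conj f g)
  have "sat V e f \<longleftrightarrow> sat V e' f" by (rule Conj.IH(1), rule Conj.prems, simp)
  moreover have "sat V e g \<longleftrightarrow> sat V e' g" by (rule Conj.IH(2), rule Conj.prems, simp)
  ultimately show ?case by simp
next
  case (Ex i f)
  have "sat V (e(i := x)) f \<longleftrightarrow> sat V (e'(i := x)) f" for x
    by (rule Ex.IH) (use Ex.prems in auto)
  then show ?case by simp
qed

lemma finite_tm_vars: "finite (tm_vars u)"
  by (induction u) auto

lemma finite_free_vars: "finite (free_vars f)"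
  by (induction f) (auto simp: finite_tm_vars)

section \<open>Terms over \<open>F\<close> and the predicates built positively from them\<close>

definition term_fun :: "((nat \<Rightarrow> 'a::field fls) \<Rightarrow> 'a fls) \<Rightarrow> bool" where
  "term_fun g \<longleftrightarrow> (\<exists>u. tm_params u \<subseteq> constants \<and> (\<forall>e. tm_val e u = g e))"

lemma term_fun_var: "term_fun (\<lambda>e. e i)"
  unfolding term_fun_def by (rule exI[of _ "Var i"]) simp

lemma term_fun_const: "term_fun (\<lambda>e. fls_const c)"
  unfolding term_fun_def by (rule exI[of _ "Param (fls_const c)"]) (simp add: constants_def)

lemma term_fun_01: "term_fun (\<lambda>e. 0)" "term_fun (\<lambda>e. 1)"
  using term_fun_const[of 0] term_fun_const[of 1] by simp_all

lemma term_fun_add: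
  assumes "term_fun g" "term_fun h"
  shows "term_fun (\<lambda>e. g e + h e)"
proof -
  obtain u w where "tm_params u \<subseteq> constants" "\<forall>e. tm_val e u = g e"
    "tm_params w \<subseteq> constants" "\<forall>e. tm_val e w = h e" using assms by (auto simp: term_fun_def)
  then show ?thesis unfolding term_fun_def by (intro exI[of _ "Add u w"]) simp
qed

lemma term_fun_mult:
  assumes "term_fun g" "term_fun h"
  shows "term_fun (\<lambda>e. g e * h e)"
proof -
  obtain u w where "tm_params u \<subseteq> constants" "\<forall>e. tm_val e u = g e"
    "tm_params w \<subseteq> constants" "\<forall>e. tm_val e w = h e" using assms by (auto simp: term_fun_def)
  then show ?thesis unfolding term_fun_def by (intro exI[of _ "Mul u w"]) simp
qed

lemma term_fun_power: "term_fun g \<Longrightarrow> term_fun (\<lambda>e. g e ^ n)"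
  by (induction n) (auto intro: term_fun_01 term_fun_mult)

lemma term_fun_sum: "(\<And>i. term_fun (g i)) \<Longrightarrow> term_fun (\<lambda>e. \<Sum>i<(n::nat). g i e)"
  by (induction n) (auto intro: term_fun_01 term_fun_add)

text \<open>Both formulas of the theorem come from one predicate of this class, read once as a ring
  formula over \<open>F\<close> and once as an existential formula over \<open>F(t)\<close>. The
  second reading rules out negation. Uniformisers are a base case because the two readings define
  them differently.\<close>

inductive positively_definable :: "((nat \<Rightarrow> 'a::field fls) \<Rightarrow> bool) \<Rightarrow> bool" where
  eq: "term_fun g \<Longrightarrow> term_fun h \<Longrightarrow> positively_definable (\<lambda>e. g e = h e)"
| ino: "term_fun g \<Longrightarrow> positively_definable (\<lambda>e. g e \<in> power_series)"
| unif: "positively_definable (\<lambda>e. fls_subdegree (e i) = 1)"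
| conj: "positively_definable P \<Longrightarrow> positively_definable Q \<Longrightarrow> positively_definable (\<lambda>e. P e \<and> Q e)"
| ex: "positively_definable P \<Longrightarrow> positively_definable (\<lambda>e. \<exists>x. P (e(i := x)))"

lemma positively_definable_all: "(\<And>j. positively_definable (P j)) \<Longrightarrow>
  positively_definable (\<lambda>e. \<forall>j<(n::nat). P j e)"
proof (induction n)
  case 0
  show ?case using positively_definable.eq[OF term_fun_01(1) term_fun_01(1)] by simp
next
  case (Suc n)
  have "positively_definable (\<lambda>e. P n e \<and> (\<forall>j<n. P j e))"
    by (rule positively_definable.conj[OF Suc.prems Suc.IH[OF Suc.prems]])
  then show ?case by (simp only: All_less_Suc)
qed

section \<open>Ring formulas with parameters from \<open>F\<close>\<close>

definition ring_definable :: "((nat \<Rightarrow> 'a::field fls) \<Rightarrow> bool) \<Rightarrow> bool" where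
  "ring_definable P \<longleftrightarrow> (\<exists>f. ring_formula f \<and> params f \<subseteq> constants \<and> (\<forall>e. sat power_series e f \<longleftrightarrow> P e))"

lemma ring_definable_eq:
  assumes "term_fun g" "term_fun h"
  shows "ring_definable (\<lambda>e. g e = h e)"
proof -
  obtain u w where "tm_params u \<subseteq> constants" "\<forall>e. tm_val e u = g e"
    "tm_params w \<subseteq> constants" "\<forall>e. tm_val e w = h e" using assms by (auto simp: term_fun_def)
  then show ?thesis unfolding ring_definable_def by (intro exI[of _ "Eq u w"]) simp
qed

lemma ring_definable_not:
  assumes "ring_definable P"
  shows "ring_definable (\<lambda>e. \<not> P e)"
proof -
  obtain f where "ring_formula f" "params f \<subseteq> constants" "\<forall>e. sat power_series e f \<longleftrightarrow> P e"
    using assms by (auto simp: ring_definable_def)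
  then show ?thesis unfolding ring_definable_def by (intro exI[of _ "Neg f"]) simp
qed

lemma ring_definable_conj:
  assumes "ring_definable P" "ring_definable Q"
  shows "ring_definable (\<lambda>e. P e \<and> Q e)"
proof -
  obtain f g where "ring_formula f" "params f \<subseteq> constants" "\<forall>e. sat power_series e f \<longleftrightarrow> P e"
    "ring_formula g" "params g \<subseteq> constants" "\<forall>e. sat power_series e g \<longleftrightarrow> Q e"
    using assms by (auto simp: ring_definable_def)
  then show ?thesis unfolding ring_definable_def by (intro exI[of _ "Conj f g"]) simp
qed

lemma ring_definable_ex:
  assumes "ring_definable P"
  shows "ring_definable (\<lambda>e. \<exists>x. P (e(i := x)))"
proof -
  obtain f where "ring_formula f" "params f \<subseteq> constants" "\<forall>e. sat power_series e f \<longleftrightarrow> P e"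
    using assms by (auto simp: ring_definable_def)
  then show ?thesis unfolding ring_definable_def by (intro exI[of _ "Ex i f"]) simp
qed

lemma ring_definable_artin_schreier:
  assumes "i \<noteq> k" "j \<noteq> k"
  shows "ring_definable (\<lambda>e. \<exists>y. y * y + y = e i * (e j * e j))"
proof -
  \<comment> \<open>The updates are spelled out to match \<open>ring_definable_ex\<close>; they
    simplify away since \<open>k\<close> differs from the other variables.\<close>
  have "ring_definable (\<lambda>e. \<exists>y. (e(k := y)) k * (e(k := y)) k + (e(k := y)) k
      = (e(k := y)) i * ((e(k := y)) j * (e(k := y)) j))"
    by (intro ring_definable_ex[where P = "\<lambda>e. e k * e k + e k = e i * (e j * e j)"]
        ring_definable_eq term_fun_add term_fun_mult term_fun_var)
  then show ?thesis using assms by simp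
qed

lemma ring_definable_artin_schreier_mult:
  assumes "i \<noteq> k" "j \<noteq> k" "l \<noteq> k"
  shows "ring_definable (\<lambda>e. \<exists>y. y * y + y = e i * ((e j * e l) * (e j * e l)))"
proof -
  have "ring_definable (\<lambda>e. \<exists>y. (e(k := y)) k * (e(k := y)) k + (e(k := y)) k
      = (e(k := y)) i * (((e(k := y)) j * (e(k := y)) l) * ((e(k := y)) j * (e(k := y)) l)))"
    by (intro ring_definable_ex[where P = "\<lambda>e. e k * e k + e k = e i * ((e j * e l) * (e j * e l))"]
        ring_definable_eq term_fun_add term_fun_mult term_fun_var)
  then show ?thesis using assms by simp
qed

lemma ring_definable_power_series_var: "ring_definable (\<lambda>e. e i \<in> power_series)"
proof -
  let ?R = "\<lambda>s x. \<exists>y. y * y + y = s * (x * x)"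
  \<comment> \<open>Variable \<open>i+1\<close> holds \<open>s\<close>, \<open>i+2\<close> holds
    \<open>w\<close> or \<open>u\<close>, \<open>i+3\<close> holds \<open>v\<close>, and
    \<open>i+4\<close> the root \<open>y\<close>. The universal condition is written as a negated
    existential one.\<close>
  have neq: "i \<noteq> i + 1" "i \<noteq> i + 4" "i + 1 \<noteq> i + 4" "i + 2 \<noteq> i + 4" "i + 3 \<noteq> i + 4" by auto
  have 1: "ring_definable (\<lambda>e. \<exists>w. \<not> ?R ((e(i+2 := w)) (i+1)) ((e(i+2 := w)) (i+2)))"
    by (rule ring_definable_ex[where P = "\<lambda>e. \<not> ?R (e (i+1)) (e (i+2))"],
        intro ring_definable_not ring_definable_artin_schreier[of _ "i+4"] neq)
  have 2: "ring_definable (\<lambda>e. \<exists>u. \<exists>v. (?R ((e(i+2 := u, i+3 := v)) (i+1)) ((e(i+2 := u, i+3 := v)) (i+2)) \<and>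
      ?R ((e(i+2 := u, i+3 := v)) (i+1)) ((e(i+2 := u, i+3 := v)) (i+3))) \<and>
      \<not> ?R ((e(i+2 := u, i+3 := v)) (i+1)) ((e(i+2 := u, i+3 := v)) (i+2) * (e(i+2 := u, i+3 := v)) (i+3)))"
    by (rule ring_definable_ex[where P = "\<lambda>e. \<exists>v. (?R ((e(i+3 := v)) (i+1)) ((e(i+3 := v)) (i+2)) \<and>
          ?R ((e(i+3 := v)) (i+1)) ((e(i+3 := v)) (i+3))) \<and>
          \<not> ?R ((e(i+3 := v)) (i+1)) ((e(i+3 := v)) (i+2) * (e(i+3 := v)) (i+3))"],
        rule ring_definable_ex[where P = "\<lambda>e. (?R (e (i+1)) (e (i+2)) \<and> ?R (e (i+1)) (e (i+3))) \<and>
          \<not> ?R (e (i+1)) (e (i+2) * e (i+3))"],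
        intro ring_definable_conj ring_definable_not ring_definable_artin_schreier[of _ "i+4"]
          ring_definable_artin_schreier_mult[of _ "i+4"] neq)
  have 3: "ring_definable (\<lambda>e. ?R (e (i+1)) (e i) \<and> (\<exists>w. \<not> ?R (e (i+1)) w) \<and>
      \<not> (\<exists>u v. (?R (e (i+1)) u \<and> ?R (e (i+1)) v) \<and> \<not> ?R (e (i+1)) (u * v)))"
    using ring_definable_conj[OF ring_definable_artin_schreier[of "i+1" "i+4" i]
      ring_definable_conj[OF 1 ring_definable_not[OF 2]]]
    by simp
  have "ring_definable (\<lambda>e. \<exists>s. ?R s (e i) \<and> (\<exists>w. \<not> ?R s w) \<and>
      \<not> (\<exists>u v. (?R s u \<and> ?R s v) \<and> \<not> ?R s (u * v)))"
    using ring_definable_ex[OF 3, of "i+1"] by simp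
  moreover have "e i \<in> power_series \<longleftrightarrow> (\<exists>s. ?R s (e i) \<and> (\<exists>w. \<not> ?R s w) \<and>
      \<not> (\<exists>u v. (?R s u \<and> ?R s v) \<and> \<not> ?R s (u * v)))" for e :: "nat \<Rightarrow> 'a fls"
    unfolding power_series_parameter_free[of "e i"] by blast
  ultimately show ?thesis by (simp only:)
qed

lemma ring_definable_power_series:
  assumes "term_fun g"
  shows "ring_definable (\<lambda>e. g e \<in> power_series)"
proof -
  obtain u where u: "tm_params u \<subseteq> constants" "\<And>e. tm_val e u = g e" using assms by (auto simp: term_fun_def)
  \<comment> \<open>A fresh variable names the value of \<open>g\<close>, which reduces the claim to
    variables.\<close>
  obtain k where k: "k \<notin> tm_vars u" using ex_new_if_finite[OF infinite_UNIV_nat finite_tm_vars] by blast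
  have g: "g (e(k := y)) = g e" for e y
    unfolding u(2)[symmetric] by (rule tm_val_cong) (use k in auto)
  have "ring_definable (\<lambda>e. \<exists>y. (e(k := y)) k = g (e(k := y)) \<and> (e(k := y)) k \<in> power_series)"
    by (rule ring_definable_ex[where P = "\<lambda>e. e k = g e \<and> e k \<in> power_series"])
      (intro ring_definable_conj ring_definable_eq term_fun_var assms ring_definable_power_series_var)
  then show ?thesis by (simp add: g)
qed

lemma ring_definable_uniformiser: "ring_definable (\<lambda>e. fls_subdegree (e i) = 1)"
proof -
  let ?O = "power_series :: 'a fls set"
  have 1: "ring_definable (\<lambda>e. \<exists>z. z \<in> ?O \<and> z * e i = 1)"
    using ring_definable_ex[where i = "i+1" and P = "\<lambda>e. e (i+1) \<in> ?O \<and> e (i+1) * e i = 1"]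
      ring_definable_conj[OF ring_definable_power_series_var[of "i+1"]
        ring_definable_eq[OF term_fun_mult[OF term_fun_var[of "i+1"] term_fun_var[of i]] term_fun_01(2)]]
    by simp
  have 2: "ring_definable (\<lambda>e. \<exists>y. y \<in> ?O \<and> y * (e i * e (i+1)) = 1)"
    using ring_definable_ex[where i = "i+2" and P = "\<lambda>e. e (i+2) \<in> ?O \<and> e (i+2) * (e i * e (i+1)) = 1"]
      ring_definable_conj[OF ring_definable_power_series_var[of "i+2"]
        ring_definable_eq[OF term_fun_mult[OF term_fun_var[of "i+2"]
          term_fun_mult[OF term_fun_var[of i] term_fun_var[of "i+1"]]] term_fun_01(2)]]
    by simp
  have 3: "ring_definable (\<lambda>e. \<exists>w. w \<notin> ?O \<and> \<not> (\<exists>y. y \<in> ?O \<and> y * (e i * w) = 1))"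
    using ring_definable_ex[where i = "i+1", OF ring_definable_conj[
      OF ring_definable_not[OF ring_definable_power_series_var[of "i+1"]] ring_definable_not[OF 2]]]
    by simp
  show ?thesis
    unfolding uniformiser_iff by (intro ring_definable_conj ring_definable_not 1 3 ring_definable_power_series_var)
qed

lemma positively_definable_ring_definable: "positively_definable P \<Longrightarrow> ring_definable P"
  by (induction rule: positively_definable.induct)
    (auto intro: ring_definable_eq ring_definable_power_series ring_definable_uniformiser
      ring_definable_conj ring_definable_ex)

text \<open>In a prenex existential formula the even variables stand for the free and the odd variables
  for the quantified ones.\<close>

definition merge :: "(nat \<Rightarrow> 'b) \<Rightarrow> (nat \<Rightarrow> 'b) \<Rightarrow> nat \<Rightarrow> 'b" where
  "merge e w i = (if even i then e (i div 2) else w (i div 2))"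

section \<open>Existential formulas with parameters from \<open>F(t)\<close>\<close>

primrec rename_tm :: "(nat \<Rightarrow> nat) \<Rightarrow> 'c tm \<Rightarrow> 'c tm" where
  "rename_tm \<pi> (Var i) = Var (\<pi> i)"
| "rename_tm \<pi> (Param c) = Param c"
| "rename_tm \<pi> Zero = Zero"
| "rename_tm \<pi> One = One"
| "rename_tm \<pi> (Add u w) = Add (rename_tm \<pi> u) (rename_tm \<pi> w)"
| "rename_tm \<pi> (Mul u w) = Mul (rename_tm \<pi> u) (rename_tm \<pi> w)"

text \<open>Bound variables are renamed without regard to capture; the lemmas on satisfaction and
  free variables are therefore restricted to quantifier-free formulas.\<close>

primrec rename_fm :: "(nat \<Rightarrow> nat) \<Rightarrow> 'c fm \<Rightarrow> 'c fm" where
  "rename_fm \<pi> (Eq u w) = Eq (rename_tm \<pi> u) (rename_tm \<pi> w)"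
| "rename_fm \<pi> (InO u) = InO (rename_tm \<pi> u)"
| "rename_fm \<pi> (Neg f) = Neg (rename_fm \<pi> f)"
| "rename_fm \<pi> (Conj f g) = Conj (rename_fm \<pi> f) (rename_fm \<pi> g)"
| "rename_fm \<pi> (Ex i f) = Ex (\<pi> i) (rename_fm \<pi> f)"

lemma tm_val_rename: "tm_val e (rename_tm \<pi> u) = tm_val (e \<circ> \<pi>) u"
  by (induction u) auto

lemma tm_params_rename [simp]: "tm_params (rename_tm \<pi> u) = tm_params u"
  by (induction u) auto

lemma tm_vars_rename: "tm_vars (rename_tm \<pi> u) = \<pi> ` tm_vars u"
  by (induction u) auto

lemma rename_fm_simps [simp]:
  "params (rename_fm \<pi> f) = params f"
  "ring_formula (rename_fm \<pi> f) = ring_formula f"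
  "quantifier_free (rename_fm \<pi> f) = quantifier_free f"
  by (induction f) auto

lemma sat_rename: "quantifier_free f \<Longrightarrow> sat V e (rename_fm \<pi> f) \<longleftrightarrow> sat V (e \<circ> \<pi>) f"
  by (induction f) (auto simp: tm_val_rename)

lemma free_vars_rename: "quantifier_free f \<Longrightarrow> free_vars (rename_fm \<pi> f) = \<pi> ` free_vars f"
  by (induction f) (auto simp: tm_vars_rename)

text \<open>Only the matrix \<open>q\<close> is kept and a whole sequence \<open>w\<close> of
  witnesses is quantified, so that conjunction and quantification merely renumber variables. A
  finite prefix is produced at the end, in \<open>existentially_definable_formula\<close>.\<close>

definition existentially_definable :: "((nat \<Rightarrow> 'a::field fls) \<Rightarrow> bool) \<Rightarrow> bool" where
  "existentially_definable P \<longleftrightarrow> (\<exists>q. quantifier_free q \<and> ring_formula q \<and> params q \<subseteq> rational_functions \<and>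
     (\<forall>e. P e \<longleftrightarrow> (\<exists>w. sat power_series (merge e w) q)))"

lemma constants_subset_rational: "constants \<subseteq> rational_functions"
  and fls_X_rational: "fls_X \<in> rational_functions"
  using subset_adjoin unfolding rational_functions_def by blast+

definition even_tm :: "'c tm \<Rightarrow> 'c tm" where
  "even_tm = rename_tm (\<lambda>i. 2 * i)"

lemma tm_val_even [simp]: "tm_val (merge e w) (even_tm u) = tm_val e u"
  unfolding even_tm_def tm_val_rename by (rule arg_cong[of _ _ "\<lambda>e. tm_val e u"]) (auto simp: merge_def)

lemma tm_params_even [simp]: "tm_params (even_tm u) = tm_params u"
  by (simp add: even_tm_def)

lemma merge_1 [simp]: "merge e w (Suc 0) = w 0"
  by (simp add: merge_def)

lemma existentially_definable_eq:
  assumes "tm_params u \<subseteq> rational_functions" "tm_params w \<subseteq> rational_functions"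
  shows "existentially_definable (\<lambda>e. tm_val e u = tm_val e w)"
  unfolding existentially_definable_def by (rule exI[of _ "Eq (even_tm u) (even_tm w)"]) (use assms in simp)

lemma existentially_definable_power_series:
  assumes "tm_params u \<subseteq> rational_functions"
  shows "existentially_definable (\<lambda>e. tm_val e u \<in> power_series)"
proof -
  \<comment> \<open>\<open>Var 1\<close> is the first quantified variable and reads
    \<open>w 0\<close>.\<close>
  define q where "q = Eq (Add (Mul (Var 1) (Var 1)) (Var 1))
    (Mul (Param fls_X) (Mul (even_tm u) (even_tm u)))"
  have X: "fls_subdegree (fls_X :: 'a fls) = 1" by simp
  have sat: "sat power_series (merge e w) q \<longleftrightarrow> w 0 * w 0 + w 0 = fls_X * (tm_val e u * tm_val e u)" for e w
    by (simp add: q_def)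
  have ex: "(\<exists>w :: nat \<Rightarrow> 'a fls. Q (w 0)) \<longleftrightarrow> (\<exists>y. Q y)" for Q
    by (auto intro: exI[of _ "\<lambda>_. _"])
  have "tm_val e u \<in> power_series \<longleftrightarrow> (\<exists>w. sat power_series (merge e w) q)" for e
    unfolding artin_schreier_uniformiser[OF X, symmetric] sat
    by (rule ex[of "\<lambda>y. y * y + y = fls_X * (tm_val e u * tm_val e u)", symmetric])
  moreover have "quantifier_free q" "ring_formula q" "params q \<subseteq> rational_functions"
    using assms fls_X_rational by (auto simp: q_def)
  ultimately show ?thesis unfolding existentially_definable_def by blast
qed

lemma existentially_definable_conj:
  assumes "existentially_definable P" "existentially_definable Q"
  shows "existentially_definable (\<lambda>e. P e \<and> Q e)"
proof -
  obtain p q where p: "quantifier_free p" "ring_formula p" "params p \<subseteq> rational_functions"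
      "\<And>e. P e \<longleftrightarrow> (\<exists>w. sat power_series (merge e w) p)"
    and q: "quantifier_free q" "ring_formula q" "params q \<subseteq> rational_functions"
      "\<And>e. Q e \<longleftrightarrow> (\<exists>w. sat power_series (merge e w) q)"
    using assms by (auto simp: existentially_definable_def)
  \<comment> \<open>The two witness sequences are interleaved: \<open>\<pi>0\<close> reads the
    witnesses with even index, \<open>\<pi>1\<close> those with odd index.\<close>
  define \<pi>0 where "\<pi>0 i = (if even i then i else 2 * (2 * (i div 2)) + 1)" for i :: nat
  define \<pi>1 where "\<pi>1 i = (if even i then i else 2 * (2 * (i div 2) + 1) + 1)" for i :: nat
  have m0: "merge e w \<circ> \<pi>0 = merge e (\<lambda>i. w (2 * i))" for e w :: "nat \<Rightarrow> 'a fls"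
    by (auto simp: merge_def \<pi>0_def)
  have m1: "merge e w \<circ> \<pi>1 = merge e (\<lambda>i. w (2 * i + 1))" for e w :: "nat \<Rightarrow> 'a fls"
    by (auto simp: merge_def \<pi>1_def)
  have "P e \<and> Q e \<longleftrightarrow> (\<exists>w. sat power_series (merge e w) (Conj (rename_fm \<pi>0 p) (rename_fm \<pi>1 q)))" for e
  proof
    assume "P e \<and> Q e"
    then obtain w w' where "sat power_series (merge e w) p" "sat power_series (merge e w') q"
      using p q by blast
    then have "sat power_series (merge e (merge w w')) (Conj (rename_fm \<pi>0 p) (rename_fm \<pi>1 q))"
      unfolding sat.simps sat_rename[OF p(1)] sat_rename[OF q(1)] m0 m1 by (simp add: merge_def)
    then show "\<exists>w. sat power_series (merge e w) (Conj (rename_fm \<pi>0 p) (rename_fm \<pi>1 q))" by blast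
  next
    assume "\<exists>w. sat power_series (merge e w) (Conj (rename_fm \<pi>0 p) (rename_fm \<pi>1 q))"
    then obtain w where "sat power_series (merge e w) (Conj (rename_fm \<pi>0 p) (rename_fm \<pi>1 q))" by blast
    then show "P e \<and> Q e" unfolding p(4) q(4) sat.simps sat_rename[OF p(1)] sat_rename[OF q(1)] m0 m1 by blast
  qed
  then show ?thesis unfolding existentially_definable_def
    by (intro exI[of _ "Conj (rename_fm \<pi>0 p) (rename_fm \<pi>1 q)"]) (use p q in simp)
qed

lemma existentially_definable_ex:
  assumes "existentially_definable P"
  shows "existentially_definable (\<lambda>e. \<exists>x. P (e(i := x)))"
proof -
  obtain q where q: "quantifier_free q" "ring_formula q" "params q \<subseteq> rational_functions"
      "\<And>e. P e \<longleftrightarrow> (\<exists>w. sat power_series (merge e w) q)"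
    using assms by (auto simp: existentially_definable_def)
  \<comment> \<open>The free variable \<open>i\<close> becomes witness 0, and the old witnesses move
    up by one.\<close>
  define \<pi> where "\<pi> k = (if k = 2 * i then 1 else if even k then k else k + 2)" for k :: nat
  have m: "merge e w \<circ> \<pi> = merge (e(i := w 0)) (\<lambda>k. w (Suc k))" for e w :: "nat \<Rightarrow> 'a fls"
    by (auto simp: merge_def \<pi>_def fun_eq_iff)
  have "(\<exists>x. P (e(i := x))) \<longleftrightarrow> (\<exists>w. sat power_series (merge e w) (rename_fm \<pi> q))" for e
  proof
    assume "\<exists>x. P (e(i := x))"
    then obtain x w where "sat power_series (merge (e(i := x)) w) q" using q by blast
    then have "sat power_series (merge e (case_nat x w)) (rename_fm \<pi> q)"
      unfolding sat_rename[OF q(1)] m by simp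
    then show "\<exists>w. sat power_series (merge e w) (rename_fm \<pi> q)" by blast
  next
    assume "\<exists>w. sat power_series (merge e w) (rename_fm \<pi> q)"
    then show "\<exists>x. P (e(i := x))" unfolding q(4) sat_rename[OF q(1)] m by blast
  qed
  then show ?thesis unfolding existentially_definable_def
    by (intro exI[of _ "rename_fm \<pi> q"]) (use q in simp)
qed

lemma existentially_definable_uniformiser: "existentially_definable (\<lambda>e. fls_subdegree (e i) = 1)"
proof -
  let ?O = "power_series :: 'a fls set"
  have O: "existentially_definable (\<lambda>e. e (i+1) \<in> ?O)"
    using existentially_definable_power_series[of "Var (i+1)"] by simp
  have 1: "existentially_definable (\<lambda>e. \<exists>u. u \<in> ?O \<and> e i = fls_X * u)"
    using existentially_definable_ex[OF existentially_definable_conj[OF O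
      existentially_definable_eq[of "Var i" "Mul (Param fls_X) (Var (i+1))"]], of "i+1"] fls_X_rational by simp
  have 2: "existentially_definable (\<lambda>e. \<exists>u. u \<in> ?O \<and> fls_X = e i * u)"
    using existentially_definable_ex[OF existentially_definable_conj[OF O
      existentially_definable_eq[of "Param fls_X" "Mul (Var i) (Var (i+1))"]], of "i+1"] fls_X_rational by simp
  show ?thesis unfolding uniformiser_iff_X by (intro existentially_definable_conj 1 2)
qed

lemma positively_definable_existentially_definable: "positively_definable P \<Longrightarrow> existentially_definable P"
proof (induction rule: positively_definable.induct)
  case (eq g h)
  then obtain u w where u: "tm_params u \<subseteq> constants" "tm_params w \<subseteq> constants"
    and "\<forall>e. tm_val e u = g e" "\<forall>e. tm_val e w = h e" by (auto simp: term_fun_def)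
  with existentially_definable_eq[OF u[THEN order_trans[OF _ constants_subset_rational]]] show ?case by simp
next
  case (ino g)
  then obtain u where u: "tm_params u \<subseteq> constants" and "\<forall>e. tm_val e u = g e"
    by (auto simp: term_fun_def)
  with existentially_definable_power_series[OF order_trans[OF u constants_subset_rational]] show ?case by simp
qed (auto intro: existentially_definable_uniformiser existentially_definable_conj existentially_definable_ex)

section \<open>Formulas with a finite quantifier prefix and few free variables\<close>

lemma foldr_Ex_simps [simp]:
  "params (foldr Ex xs f) = params f"
  "ring_formula (foldr Ex xs f) = ring_formula f"
  "free_vars (foldr Ex xs f) = free_vars f - set xs"
  "quantifier_free f \<Longrightarrow> existential (foldr Ex xs f)"
proof -
  show "quantifier_free f \<Longrightarrow> existential (foldr Ex xs f)"
    by (induction xs) (cases f; simp)+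
qed (induction xs; auto)+

lemma sat_foldr_Ex:
  "sat V e (foldr Ex xs f) \<longleftrightarrow> (\<exists>e'. (\<forall>i. i \<notin> set xs \<longrightarrow> e' i = e i) \<and> sat V e' f)"
proof (induction xs arbitrary: e)
  case Nil
  show ?case by (auto simp: fun_eq_iff[symmetric])
next
  case (Cons j xs)
  have "sat V e (foldr Ex (j # xs) f) \<longleftrightarrow>
      (\<exists>x e'. (\<forall>i. i \<notin> set xs \<longrightarrow> e' i = (e(j := x)) i) \<and> sat V e' f)"
    by (simp add: Cons.IH)
  also have "\<dots> \<longleftrightarrow> (\<exists>e'. (\<forall>i. i \<notin> set (j # xs) \<longrightarrow> e' i = e i) \<and> sat V e' f)"
  proof
    assume "\<exists>e'. (\<forall>i. i \<notin> set (j # xs) \<longrightarrow> e' i = e i) \<and> sat V e' f"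
    then obtain e' where "\<forall>i. i \<notin> set (j # xs) \<longrightarrow> e' i = e i" "sat V e' f" by blast
    then show "\<exists>x e'. (\<forall>i. i \<notin> set xs \<longrightarrow> e' i = (e(j := x)) i) \<and> sat V e' f"
      by (intro exI[of _ "e' j"] exI[of _ e']) auto
  next
    assume "\<exists>x e'. (\<forall>i. i \<notin> set xs \<longrightarrow> e' i = (e(j := x)) i) \<and> sat V e' f"
    then obtain x e' where "\<forall>i. i \<notin> set xs \<longrightarrow> e' i = (e(j := x)) i" "sat V e' f" by blast
    then show "\<exists>e'. (\<forall>i. i \<notin> set (j # xs) \<longrightarrow> e' i = e i) \<and> sat V e' f"
      by (intro exI[of _ e']) auto
  qed
  finally show ?case .
qed

text \<open>The semantic counterpart of having free variables below \<open>n\<close>: surplus free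
  variables of a defining formula can then be quantified away.\<close>

definition depends_below :: "((nat \<Rightarrow> 'b) \<Rightarrow> bool) \<Rightarrow> nat \<Rightarrow> bool" where
  "depends_below P n \<longleftrightarrow> (\<forall>e e'. (\<forall>i<n. e i = e' i) \<longrightarrow> P e = P e')"

lemma depends_belowD: "depends_below P n \<Longrightarrow> (\<And>i. i < n \<Longrightarrow> e i = e' i) \<Longrightarrow> P e = P e'"
  unfolding depends_below_def by blast

lemma ring_definable_formula:
  assumes "ring_definable P" "depends_below P n"
  shows "\<exists>f \<in> formulas constants n. ring_formula f \<and> (\<forall>e. sat power_series e f \<longleftrightarrow> P e)"
proof -
  obtain g where g: "ring_formula g" "params g \<subseteq> constants" "\<And>e. sat power_series e g \<longleftrightarrow> P e"
    using assms by (auto simp: ring_definable_def)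
  \<comment> \<open>Quantifying the variables from \<open>n\<close> on does not change the meaning,
    because \<open>P\<close> ignores them.\<close>
  define xs where "xs = sorted_list_of_set (free_vars g - {..<n})"
  have xs: "set xs = free_vars g - {..<n}" by (simp add: xs_def finite_free_vars)
  have "sat power_series e (foldr Ex xs g) \<longleftrightarrow> P e" for e
    unfolding sat_foldr_Ex g(3) using depends_belowD[OF assms(2)] by (metis DiffD2 lessThan_iff xs)
  then show ?thesis using g xs
    by (intro bexI[of _ "foldr Ex xs g"]) (auto simp: formulas_def)
qed

lemma existentially_definable_formula:
  assumes "existentially_definable P" "depends_below P n"
  shows "\<exists>f \<in> formulas rational_functions n. ring_formula f \<and> existential f \<and>
    (\<forall>e. sat power_series e f \<longleftrightarrow> P e)"
proof -
  obtain q where q: "quantifier_free q" "ring_formula q" "params q \<subseteq> rational_functions"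
      "\<And>e. P e \<longleftrightarrow> (\<exists>w. sat power_series (merge e w) q)"
    using assms by (auto simp: existentially_definable_def)
  obtain B0 where B0: "free_vars q \<subseteq> {..<B0}"
    using finite_nat_iff_bounded finite_free_vars by blast
  define B where "B = max n B0"
  have B: "free_vars q \<subseteq> {..<B}" "n \<le> B" using B0 by (auto simp: B_def)
  \<comment> \<open>Free variable \<open>k\<close> goes to \<open>k\<close>, and witness
    \<open>k\<close> to \<open>B + k\<close>. The prefix over \<open>[n..<2 * B]\<close> binds the
    witnesses and also the free variables between \<open>n\<close> and \<open>B\<close>, on which
    \<open>P\<close> does not depend.\<close>
  define \<pi> where "\<pi> k = (if even k then k div 2 else B + k div 2)" for k :: nat
  define f where "f = foldr Ex [n..<2 * B] (rename_fm \<pi> q)"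
  have "\<pi> k < 2 * B" if "k \<in> free_vars q" for k
    using that B by (auto simp: \<pi>_def)
  then have "free_vars f \<subseteq> {..<n}" by (auto simp: f_def free_vars_rename[OF q(1)])
  moreover have "sat power_series e f \<longleftrightarrow> P e" for e
  proof
    assume "sat power_series e f"
    then obtain e' where e': "\<forall>i. i \<notin> set [n..<2 * B] \<longrightarrow> e' i = e i" "sat power_series (e' \<circ> \<pi>) q"
      by (auto simp: f_def sat_foldr_Ex sat_rename[OF q(1)])
    have "e' \<circ> \<pi> = merge e' (\<lambda>k. e' (B + k))" by (auto simp: merge_def \<pi>_def)
    then have "P e'" using e'(2) q(4) by auto
    moreover have "P e' = P e" using e'(1) by (intro depends_belowD[OF assms(2)]) simp
    ultimately show "P e" by simp
  next
    assume "P e"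
    then obtain w where w: "sat power_series (merge e w) q" using q(4) by blast
    define e' where "e' i = (if i < B then e i else if i < 2 * B then w (i - B) else e i)" for i
    define e'' where "e'' i = (if i < n then e i else e' i)" for i
    have "sat power_series (e'' \<circ> \<pi>) q \<longleftrightarrow> sat power_series (merge e w) q"
    proof (rule sat_cong)
      fix k assume "k \<in> free_vars q"
      then have "k < B" using B by auto
      then show "(e'' \<circ> \<pi>) k = merge e w k"
        using B(2) by (auto simp: e''_def e'_def \<pi>_def merge_def)
    qed
    moreover have "\<forall>i. i \<notin> set [n..<2 * B] \<longrightarrow> e'' i = e i" by (auto simp: e''_def e'_def)
    ultimately show "sat power_series e f" using w
      unfolding f_def sat_foldr_Ex sat_rename[OF q(1)] by blast
  qed
  ultimately show ?thesis using q
    by (intro bexI[of _ f]) (auto simp: formulas_def f_def)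
qed

section \<open>The orbit as a definable set\<close>

lemma positively_definable_near_truncation:
  "positively_definable (\<lambda>e. near_truncation b N (e i) (e k))"
proof -
  define l where "l = i + k + 1"
  have l: "i \<noteq> l" "k \<noteq> l" by (auto simp: l_def)
  define M where "M = nat (- fls_subdegree b)"
  have "positively_definable (\<lambda>e. \<exists>u. (e(l := u)) l \<in> power_series \<and> (e(l := u)) k * (e(l := u)) i ^ M
       = (\<Sum>j<M + N. fls_const (b $$ (int j - int M)) * (e(l := u)) i ^ j) + (e(l := u)) l * (e(l := u)) i ^ (M + N))"
    by (rule positively_definable.ex[where P = "\<lambda>e. e l \<in> power_series \<and> e k * e i ^ M
       = (\<Sum>j<M + N. fls_const (b $$ (int j - int M)) * e i ^ j) + e l * e i ^ (M + N)"],
       intro positively_definable.conj positively_definable.ino positively_definable.eq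
         term_fun_add term_fun_mult term_fun_power
         term_fun_sum term_fun_const term_fun_var)
  then show ?thesis using l by (simp add: near_truncation_def Let_def M_def Bex_def)
qed

lemma positively_definable_bipoly: "positively_definable (\<lambda>e. bipoly c D (e i) (e k) = 0)"
  unfolding bipoly_def
  by (intro positively_definable.eq term_fun_sum term_fun_mult term_fun_power term_fun_const term_fun_var term_fun_01)

theorem theorem1:
  fixes a :: "'a::field fls list"
  assumes "perfect_field TYPE('a)"
    and "has_transcendence_degree constants (set a) 1"
  shows "(\<exists>f \<in> formulas rational_functions (length a).
            ring_formula f \<and> existential f \<and> orbit a = solutions power_series (length a) f)
       \<and> (\<exists>f \<in> formulas constants (length a).
            ring_formula f \<and> orbit a = solutions power_series (length a) f)
       \<and> orbit a = realisations power_series (length a) (complete_type power_series constants a)"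
proof -
  define n where "n = length a"
  obtain r c D where r: "fls_deriv r \<noteq> 0" and
    rel: "\<And>j. j < length a \<Longrightarrow> total_degree_less (c j) (D j) \<and> bipoly (c j) (D j) r (a ! j) = 0 \<and>
       bipoly (deriv2 (c j)) (D j) r (a ! j) \<noteq> 0"
    by (rule transcendence_degree_1_separating[OF assms]) blast
  obtain N :: nat where N: "\<forall>x b. x - r \<in> fls_val_ge N \<and> length b = length a \<and>
     (\<forall>j<length a. b ! j - a ! j \<in> fls_val_ge N \<and> bipoly (c j) (D j) x (b ! j) = 0) \<longrightarrow> b \<in> orbit a"
    using orbit_neighbourhood[OF r rel] by blast
  \<comment> \<open>\<open>r\<close> need not be among the coordinates of \<open>a\<close>, so its
    counterpart \<open>x\<close> is quantified like \<open>s\<close>.\<close>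
  define P where "P e \<longleftrightarrow> (\<exists>s. fls_subdegree s = 1 \<and> (\<exists>x. near_truncation r N s x \<and>
      (\<forall>j<n. near_truncation (a ! j) N s (e j) \<and> bipoly (c j) (D j) x (e j) = 0)))"
    for e :: "nat \<Rightarrow> 'a fls"
  have dep: "depends_below P n" unfolding depends_below_def P_def by auto
  have pos: "positively_definable P"
  proof -
    \<comment> \<open>Variables \<open>n\<close> and \<open>n+1\<close>, just beyond the
      coordinates, hold \<open>s\<close> and \<open>x\<close>.\<close>
    define Q where "Q j = (\<lambda>e :: nat \<Rightarrow> 'a fls. near_truncation (a ! j) N (e n) (e j) \<and>
      bipoly (c j) (D j) (e (n+1)) (e j) = 0)" for j
    have 1: "positively_definable (\<lambda>e. near_truncation r N (e n) (e (n+1)) \<and> (\<forall>j<n. Q j e))"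
      unfolding Q_def
      by (intro positively_definable.conj positively_definable_all
          positively_definable_near_truncation positively_definable_bipoly)
    have "positively_definable (\<lambda>e. \<exists>s. fls_subdegree ((e(n := s)) n) = 1 \<and>
        (\<exists>x. near_truncation r N ((e(n := s, n+1 := x)) n) ((e(n := s, n+1 := x)) (n+1)) \<and>
          (\<forall>j<n. Q j (e(n := s, n+1 := x)))))"
      by (rule positively_definable.ex[where P = "\<lambda>e. fls_subdegree (e n) = 1 \<and>
          (\<exists>x. near_truncation r N ((e(n+1 := x)) n) ((e(n+1 := x)) (n+1)) \<and> (\<forall>j<n. Q j (e(n+1 := x))))"])
        (intro positively_definable.conj positively_definable.unif positively_definable.ex[OF 1])
    then show ?thesis by (simp add: P_def[abs_def] Q_def)
  qed
  obtain f where f: "f \<in> formulas constants n" "ring_formula f" "\<And>e. sat power_series e f \<longleftrightarrow> P e"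
    using ring_definable_formula[OF positively_definable_ring_definable[OF pos] dep] by blast
  obtain g where g: "g \<in> formulas rational_functions n" "ring_formula g" "existential g"
    "\<And>e. sat power_series e g \<longleftrightarrow> P e"
    using existentially_definable_formula[OF positively_definable_existentially_definable[OF pos] dep] by blast
  have sat_orbit: "sat power_series (\<lambda>i. b ! i) h \<longleftrightarrow> sat power_series (\<lambda>i. a ! i) h"
    if b: "b \<in> orbit a" and h: "h \<in> formulas constants n" for b h
  proof -
    obtain \<sigma> where \<sigma>: "\<sigma> \<in> valued_field_automorphisms" "b = map \<sigma> a" using b by (auto simp: orbit_def)
    have "sat power_series (\<lambda>i. b ! i) h \<longleftrightarrow> sat power_series (\<sigma> \<circ> (\<lambda>i. a ! i)) h"
      using h by (intro sat_cong) (auto simp: formulas_def \<sigma>(2) n_def)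
    then show ?thesis using sat_automorphism[OF \<sigma>(1)] h by (simp add: formulas_def)
  qed
  have "P (\<lambda>i. a ! i)"
    unfolding P_def
    by (intro exI[of _ fls_X] exI[of _ r] conjI) (auto simp: near_truncation_X rel n_def)
  then have fa: "sat power_series (\<lambda>i. a ! i) f" by (simp add: f(3))
  \<comment> \<open>From left to right, \<open>P\<close> holds at \<open>a\<close> and is expressed
    by \<open>f\<close> over \<open>F\<close>, so automorphisms preserve it.\<close>
  have iff: "b \<in> orbit a \<longleftrightarrow> length b = n \<and> P (\<lambda>i. b ! i)" for b
  proof
    assume b: "b \<in> orbit a"
    then show "length b = n \<and> P (\<lambda>i. b ! i)"
      using sat_orbit[OF b f(1)] fa by (auto simp: f(3) orbit_def n_def)
  next
    assume "length b = n \<and> P (\<lambda>i. b ! i)"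
    then show "b \<in> orbit a" unfolding P_def n_def using orbit_contains[OF N] by blast
  qed
  have "orbit a = solutions power_series n g" "orbit a = solutions power_series n f"
    by (auto simp: solutions_def iff f(3) g(4))
  moreover have "orbit a = realisations power_series n (complete_type power_series constants a)"
  proof (intro equalityI subsetI)
    fix b assume b: "b \<in> orbit a"
    then have "length b = n" by (simp add: iff)
    then show "b \<in> realisations power_series n (complete_type power_series constants a)"
      using sat_orbit[OF b] by (auto simp: realisations_def complete_type_def n_def)
  next
    fix b assume "b \<in> realisations power_series n (complete_type power_series constants a)"
    \<comment> \<open>The single member \<open>f\<close> of the type already cuts out the
      orbit.\<close>
    moreover have "f \<in> complete_type power_series constants a"
      using f(1) fa by (simp add: complete_type_def n_def)
    ultimately show "b \<in> orbit a" by (auto simp: iff realisations_def f(3))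
  qed
  ultimately show ?thesis using f g unfolding n_def by blast
qed

end
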